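(* Let $\mathcal{F}=(\mathcal{X}_n,K_n,\pi_n)_{n=1}^\infty$ be a family of irreducible Markov chains on countable state spaces, with (maximum) total variation and Hellinger mixing times $T_{n,\mathrm{TV}}(\cdot)$ and $T_{n,H}(\cdot)$. Suppose that there is $\epsilon_0\in(0,1)$ such that $T_{n,\mathrm{TV}}(\epsilon_0)\to\infty$ or $T_{n,H}(\epsilon_0)\to\infty$ as $n\to\infty$. Then $\mathcal{F}$ has a cutoff in the total variation if and only if $\mathcal{F}$ has a cutoff in the Hellinger distance. Further, if $\mathcal{F}$ has a cutoff in either the total variation or the Hellinger distance, then $$\lim_{n\to\infty}\frac{T_{n,\mathrm{TV}}(\epsilon)}{T_{n,H}(\delta)}=1\qquad\text{for all }\epsilon,\delta\in(0,1).$$ In the continuous time case, the same conclusions hold for the family $\mathcal{F}_c$ of associated continuous time chains (with $T^{(c)}_{n,\mathrm{TV}},T^{(c)}_{n,H}$ in place of $T_{n,\mathrm{TV}},T_{n,H}$), without the assumption that $T^{(c)}_{n,\mathrm{TV}}(\epsilon_0)\to\infty$ or $T^{(c)}_{n,H}(\epsilon_0)\to\infty$.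
   Context: A Markov chain $(\mathcal{X},K,\pi)$ consists of a countable set $\mathcal{X}$, an irreducible stochastic matrix $K$ indexed by $\mathcal{X}$ and a stationary probability $\pi$ of $K$. Its (maximum) total variation and Hellinger distances are $$d_{\mathrm{TV}}(m)=\sup_{x\in\mathcal{X},A\subset\mathcal{X}}\{K^m(x,A)-\pi(A)\},\qquad d_H(m)=\sup_{x\in\mathcal{X}}\Big(\tfrac12\sum_{y\in\mathcal{X}}\big(\sqrt{K^m(x,y)}-\sqrt{\pi(y)}\big)^2\Big)^{1/2},$$ and the mixing times are $T_{\mathrm{TV}}(\epsilon)=\inf\{m\ge0: d_{\mathrm{TV}}(m)\le\epsilon\}$, $T_H(\epsilon)=\inf\{m\ge 0: d_H(m)\le\epsilon\}$. The associated continuous time chain is $(\mathcal{X},H_t,\pi)$ with $H_t=e^{-t(I-K)}$, $t\ge0$; replacing $K^m$ by $H_t$ gives $d^{(c)}_{\mathrm{TV}}(t),d^{(c)}_H(t)$ and $T^{(c)}_{\mathrm{TV}}(\epsilon),T^{(c)}_H(\epsilon)$ (infimum over real $t\ge 0$). A subscript $n$ refers to the $n$th chain of the family; $\mathcal{F}_c=(\mathcal{X}_n,e^{-t(I-K_n)},\pi_n)_{n=1}^\infty$. For $*\in\{\mathrm{TV},H\}$, $\mathcal{F}$ has a cutoff in the distance $d_{n,*}$ if there are $t_n>0$ with $d_{n,*}(\lceil at_n\rceil)\to0$ for all $a>1$ and $d_{n,*}(\lfloor at_n\rfloor)\to1$ for all $a\in(0,1)$. (When $T_{n,*}(\epsilon_0)\to\infty$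 for some $\epsilon_0\in(0,1)$ this is equivalent to $T_{n,*}(\epsilon)/T_{n,*}(\delta)\to1$ for all $\epsilon,\delta\in(0,1)$.) For $\mathcal{F}_c$ the definition is the same with $d^{(c)}_{n,*}(at_n)$, without integer rounding. *)

theory Defs
  imports "HOL-Analysis.Analysis"
begin

text \<open>
  A matrix indexed by a set \<open>X\<close> is a function \<open>'a \<Rightarrow> 'a \<Rightarrow> real\<close> of which only the values on
  \<open>X \<times> X\<close> matter.
\<close>

definition id_matrix :: "'a \<Rightarrow> 'a \<Rightarrow> real" where
  "id_matrix x y = (if x = y then 1 else 0)"

definition matrix_mult :: "'a set \<Rightarrow> ('a \<Rightarrow> 'a \<Rightarrow> real) \<Rightarrow> ('a \<Rightarrow> 'a \<Rightarrow> real) \<Rightarrow> 'a \<Rightarrow> 'a \<Rightarrow> real" where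
  "matrix_mult X A B x y = (\<Sum>\<^sub>\<infinity>z\<in>X. A x z * B z y)"

primrec matrix_power :: "'a set \<Rightarrow> ('a \<Rightarrow> 'a \<Rightarrow> real) \<Rightarrow> nat \<Rightarrow> 'a \<Rightarrow> 'a \<Rightarrow> real" where
  "matrix_power X A 0 = id_matrix"
| "matrix_power X A (Suc m) = matrix_mult X (matrix_power X A m) A"

text \<open>
  The exponential series is taken entrywise.  For matrices with uniformly bounded absolute row
  sums, such as \<open>-t(I - K)\<close>, it agrees with the exponential of the corresponding bounded operator.
\<close>

definition matrix_exp :: "'a set \<Rightarrow> ('a \<Rightarrow> 'a \<Rightarrow> real) \<Rightarrow> 'a \<Rightarrow> 'a \<Rightarrow> real" where
  "matrix_exp X A x y = (\<Sum>j. matrix_power X A j x y / fact j)"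

definition probability_on :: "'a set \<Rightarrow> ('a \<Rightarrow> real) \<Rightarrow> bool" where
  "probability_on X p \<longleftrightarrow> (\<forall>x\<in>X. 0 \<le> p x) \<and> (p has_sum 1) X"

definition stochastic_matrix :: "'a set \<Rightarrow> ('a \<Rightarrow> 'a \<Rightarrow> real) \<Rightarrow> bool" where
  "stochastic_matrix X K \<longleftrightarrow> (\<forall>x\<in>X. probability_on X (K x))"

definition irreducible_matrix :: "'a set \<Rightarrow> ('a \<Rightarrow> 'a \<Rightarrow> real) \<Rightarrow> bool" where
  "irreducible_matrix X K \<longleftrightarrow> (\<forall>x\<in>X. \<forall>y\<in>X. \<exists>m. 0 < matrix_power X K m x y)"

definition stationary_probability :: "'a set \<Rightarrow> ('a \<Rightarrow> 'a \<Rightarrow> real) \<Rightarrow> ('a \<Rightarrow> real) \<Rightarrow> bool" where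
  "stationary_probability X K \<pi> \<longleftrightarrow>
     probability_on X \<pi> \<and> (\<forall>y\<in>X. ((\<lambda>x. \<pi> x * K x y) has_sum \<pi> y) X)"

definition markov_chain :: "'a set \<Rightarrow> ('a \<Rightarrow> 'a \<Rightarrow> real) \<Rightarrow> ('a \<Rightarrow> real) \<Rightarrow> bool" where
  "markov_chain X K \<pi> \<longleftrightarrow>
     countable X \<and> stochastic_matrix X K \<and> irreducible_matrix X K \<and> stationary_probability X K \<pi>"

definition heat_kernel :: "'a set \<Rightarrow> ('a \<Rightarrow> 'a \<Rightarrow> real) \<Rightarrow> real \<Rightarrow> 'a \<Rightarrow> 'a \<Rightarrow> real" where
  "heat_kernel X K t = matrix_exp X (\<lambda>x y. - t * (id_matrix x y - K x y))"

definition max_tv_dist :: "'a set \<Rightarrow> ('a \<Rightarrow> 'a \<Rightarrow> real) \<Rightarrow> ('a \<Rightarrow> real) \<Rightarrow> real" where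
  "max_tv_dist X P \<pi> = (SUP (x, A) \<in> X \<times> Pow X. (\<Sum>\<^sub>\<infinity>y\<in>A. P x y) - (\<Sum>\<^sub>\<infinity>y\<in>A. \<pi> y))"

definition max_hellinger_dist :: "'a set \<Rightarrow> ('a \<Rightarrow> 'a \<Rightarrow> real) \<Rightarrow> ('a \<Rightarrow> real) \<Rightarrow> real" where
  "max_hellinger_dist X P \<pi> =
     (SUP x\<in>X. sqrt (1 / 2 * (\<Sum>\<^sub>\<infinity>y\<in>X. (sqrt (P x y) - sqrt (\<pi> y))\<^sup>2)))"

definition d_TV :: "'a set \<Rightarrow> ('a \<Rightarrow> 'a \<Rightarrow> real) \<Rightarrow> ('a \<Rightarrow> real) \<Rightarrow> nat \<Rightarrow> real" where
  "d_TV X K \<pi> m = max_tv_dist X (matrix_power X K m) \<pi>"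

definition d_H :: "'a set \<Rightarrow> ('a \<Rightarrow> 'a \<Rightarrow> real) \<Rightarrow> ('a \<Rightarrow> real) \<Rightarrow> nat \<Rightarrow> real" where
  "d_H X K \<pi> m = max_hellinger_dist X (matrix_power X K m) \<pi>"

definition dc_TV :: "'a set \<Rightarrow> ('a \<Rightarrow> 'a \<Rightarrow> real) \<Rightarrow> ('a \<Rightarrow> real) \<Rightarrow> real \<Rightarrow> real" where
  "dc_TV X K \<pi> t = max_tv_dist X (heat_kernel X K t) \<pi>"

definition dc_H :: "'a set \<Rightarrow> ('a \<Rightarrow> 'a \<Rightarrow> real) \<Rightarrow> ('a \<Rightarrow> real) \<Rightarrow> real \<Rightarrow> real" where
  "dc_H X K \<pi> t = max_hellinger_dist X (heat_kernel X K t) \<pi>"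

text \<open>
  Mixing times are extended reals: a chain that never gets within distance \<open>\<epsilon>\<close> (a periodic one,
  for example) has mixing time \<open>Inf {} = \<infinity>\<close>.
\<close>

definition mixing_time :: "(nat \<Rightarrow> real) \<Rightarrow> real \<Rightarrow> ereal" where
  "mixing_time d \<epsilon> = Inf {ereal (real m) | m. d m \<le> \<epsilon>}"

definition mixing_time_c :: "(real \<Rightarrow> real) \<Rightarrow> real \<Rightarrow> ereal" where
  "mixing_time_c d \<epsilon> = Inf {ereal t | t. 0 \<le> t \<and> d t \<le> \<epsilon>}"

text \<open>Families are indexed by \<open>n \<ge> 1\<close>; nothing is required of the index \<open>0\<close>.\<close>

definition cutoff :: "(nat \<Rightarrow> nat \<Rightarrow> real) \<Rightarrow> bool" where
  "cutoff d \<longleftrightarrow> (\<exists>t :: nat \<Rightarrow> real. (\<forall>n\<ge>1. 0 < t n) \<and>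
     (\<forall>a>1. (\<lambda>n. d n (nat \<lceil>a * t n\<rceil>)) \<longlonglongrightarrow> 0) \<and>
     (\<forall>a. 0 < a \<and> a < 1 \<longrightarrow> (\<lambda>n. d n (nat \<lfloor>a * t n\<rfloor>)) \<longlonglongrightarrow> 1))"

definition cutoff_c :: "(nat \<Rightarrow> real \<Rightarrow> real) \<Rightarrow> bool" where
  "cutoff_c d \<longleftrightarrow> (\<exists>t :: nat \<Rightarrow> real. (\<forall>n\<ge>1. 0 < t n) \<and>
     (\<forall>a>1. (\<lambda>n. d n (a * t n)) \<longlonglongrightarrow> 0) \<and>
     (\<forall>a. 0 < a \<and> a < 1 \<longrightarrow> (\<lambda>n. d n (a * t n)) \<longlonglongrightarrow> 1))"

end

theory Submission
  imports Defs
begin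

text \<open>
  Write \<open>D\<close> and \<open>h\<close> for the total variation and Hellinger distances of two probability vectors
  \<open>p\<close> and \<open>q\<close>.  Then \<open>1 - D\<close> is the sum of the pointwise minima of \<open>p\<close> and \<open>q\<close>, and \<open>1 - h\<^sup>2\<close> the sum of
  their geometric means.  Comparing the two sums, in one direction by Cauchy-Schwarz, gives
  \<open>h\<^sup>2 \<le> D\<close> and \<open>D\<^sup>2 \<le> 1 - (1 - h\<^sup>2)\<^sup>2\<close>, and both inequalities persist for the suprema over the
  starting state (\<open>comparable_max_dists\<close>).  Consequently one distance tends to 0, or to 1, exactly when
  the other does (\<open>comparable_tendsto_0\<close>, \<open>comparable_tendsto_1\<close>).  A cutoff is a statement about these
  two limits along a sequence of times, so the same times \<open>t n\<close> witness a cutoff for either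
  distance, in discrete and in continuous time.

  It remains to see that, under a cutoff at \<open>t n\<close>, every mixing time at a level in \<open>(0, 1)\<close> is
  asymptotic to \<open>t n\<close> (\<open>mixing_time_asymptotic\<close>, \<open>mixing_time_c_asymptotic\<close>).  This needs the distances to
  decrease in time, so that a distance close to 1 at time \<open>a * t n\<close> excludes mixing before that time.
  In discrete time it also needs \<open>t n\<close> to diverge, so that integer rounding does not matter; this
  is what a divergent mixing time provides.

  Monotonicity is a data processing inequality (\<open>affinity.data_processing\<close>): the minimum and the
  geometric mean are homogeneous and superadditive, so applying a stochastic matrix to both vectors
  can only increase the sums above, and the stationary vector is fixed.  In continuous time the
  matrix applied is \<open>H\<^sub>s\<close>.  Expanding the exponential identifies \<open>H\<^sub>s\<close> with a Poisson mixture of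
  the powers of \<open>K\<close> (\<open>has_sum_heat_kernel\<close>), which shows that it is stochastic, preserves the
  stationary vector and satisfies the semigroup law (\<open>heat_kernel_add\<close>).
\<close>

section \<open>Interchange of nonnegative sums\<close>

text \<open>
  Tonelli's theorem for iterated sums: every interchange of summations below, between states and
  between states and the steps of a Poisson clock, is an instance.
\<close>

lemma has_sum_swap_nonneg:
  fixes f :: "'a \<Rightarrow> 'b \<Rightarrow> real"
  assumes nonneg: "\<And>x y. x \<in> A \<Longrightarrow> y \<in> B \<Longrightarrow> 0 \<le> f x y"
    and rows: "\<And>x. x \<in> A \<Longrightarrow> (f x has_sum g x) B"
    and total: "(g has_sum S) A"
  shows "((\<lambda>y. \<Sum>\<^sub>\<infinity>x\<in>A. f x y) has_sum S) B"
    and "\<And>y. y \<in> B \<Longrightarrow> (\<lambda>x. f x y) summable_on A"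
proof -
  have "(\<lambda>(x, y). f x y) summable_on A \<times> B"
    by (rule summable_on_SigmaI[where g = g])
      (use rows total nonneg in \<open>auto dest: has_sum_imp_summable\<close>)
  then have "((\<lambda>(x, y). f x y) has_sum S) (A \<times> B)"
    by (intro has_sum_SigmaI[OF _ total]) (use rows in auto)
  then have swapped: "((\<lambda>(y, x). f x y) has_sum S) (B \<times> A)"
    by (subst (asm) has_sum_swap) (simp add: case_prod_unfold)
  show col: "(\<lambda>x. f x y) summable_on A" if "y \<in> B" for y
    using summable_on_SigmaD1[OF has_sum_imp_summable[OF swapped] that] by simp
  show "((\<lambda>y. \<Sum>\<^sub>\<infinity>x\<in>A. f x y) has_sum S) B"
    by (rule has_sum_SigmaD[OF swapped]) (use col in auto)
qed

lemma has_sum_diff: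
  fixes f g :: "'a \<Rightarrow> real"
  assumes "(f has_sum a) A" "(g has_sum b) A"
  shows "((\<lambda>x. f x - g x) has_sum (a - b)) A"
  using has_sum_add[OF assms(1) has_sum_uminusI[OF assms(2)]] by simp

section \<open>Kernels acting on row vectors\<close>

definition push :: "'a set \<Rightarrow> ('a \<Rightarrow> real) \<Rightarrow> ('a \<Rightarrow> 'a \<Rightarrow> real) \<Rightarrow> 'a \<Rightarrow> real" where
  "push X p Q y = (\<Sum>\<^sub>\<infinity>z\<in>X. p z * Q z y)"

lemma push_cong:
  assumes "\<And>z. z \<in> X \<Longrightarrow> p z = p' z" and "\<And>z. z \<in> X \<Longrightarrow> Q z y = Q' z y"
  shows "push X p Q y = push X p' Q' y"
  unfolding push_def using assms by (intro infsum_cong) simp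

text \<open>
  Powers are built by multiplication on the right, so one step of the chain transports each row, as
  a probability vector, through \<open>K\<close>.  This is why data processing, a statement about
  images under a kernel, controls the distances from one time to the next.
\<close>

lemma matrix_power_Suc_push:
  "matrix_power X K (Suc m) x = push X (matrix_power X K m x) K"
  by (rule ext) (simp add: matrix_mult_def push_def)

lemma probability_onD:
  assumes "probability_on X p"
  shows "\<And>x. x \<in> X \<Longrightarrow> 0 \<le> p x" and "(p has_sum 1) X"
  using assms by (auto simp: probability_on_def)

lemma stochastic_matrixD:
  assumes "stochastic_matrix X Q" "x \<in> X"
  shows "probability_on X (Q x)" "\<And>y. y \<in> X \<Longrightarrow> 0 \<le> Q x y" and "(Q x has_sum 1) X"
  using assms by (auto simp: probability_on_def stochastic_matrix_def)

lemma stochastic_matrix_le_1: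
  assumes "stochastic_matrix X Q" "x \<in> X" "y \<in> X"
  shows "Q x y \<le> 1"
  using finite_sum_le_has_sum[OF stochastic_matrixD(3)[OF assms(1,2)], of "{y}"]
    stochastic_matrixD(2)[OF assms(1,2)] assms(3) by auto

lemma
  assumes p: "probability_on X p" and Q: "stochastic_matrix X Q"
  shows probability_on_push: "probability_on X (push X p Q)"
    and has_sum_push: "y \<in> X \<Longrightarrow> ((\<lambda>z. p z * Q z y) has_sum push X p Q y) X"
proof -
  note pD = probability_onD[OF p] and QD = stochastic_matrixD[OF Q]
  have rows: "((\<lambda>y. p z * Q z y) has_sum p z) X" if "z \<in> X" for z
    using has_sum_cmult_right[OF QD(3)[OF that], of "p z"] by simp
  note sw = has_sum_swap_nonneg[of X X "\<lambda>z y. p z * Q z y", OF _ rows pD(2)]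
  show "y \<in> X \<Longrightarrow> ((\<lambda>z. p z * Q z y) has_sum push X p Q y) X"
    unfolding push_def using sw(2) pD(1) QD(2) by (intro has_sum_infsum) simp
  have "(push X p Q has_sum 1) X"
    unfolding push_def using sw(1) pD(1) QD(2) by simp
  moreover have "0 \<le> push X p Q y" if "y \<in> X" for y
    unfolding push_def using pD(1) QD(2) that by (intro infsum_nonneg) simp
  ultimately show "probability_on X (push X p Q)"
    by (simp add: probability_on_def)
qed

lemma push_push:
  assumes p: "probability_on X p" and Q: "stochastic_matrix X Q" and R: "stochastic_matrix X R"
    and y: "y \<in> X"
  shows "push X (push X p Q) R y = push X p (\<lambda>z. push X (Q z) R) y"
proof -
  note pD = probability_onD[OF p] and QD = stochastic_matrixD[OF Q] and RD = stochastic_matrixD[OF R]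
  have QR: "stochastic_matrix X (\<lambda>z. push X (Q z) R)"
    using probability_on_push[OF QD(1) R] by (simp add: stochastic_matrix_def)
  have "((\<lambda>w. \<Sum>\<^sub>\<infinity>z\<in>X. p z * (Q z w * R w y)) has_sum push X p (\<lambda>z. push X (Q z) R) y) X"
  proof (rule has_sum_swap_nonneg(1))
    show "((\<lambda>w. p z * (Q z w * R w y)) has_sum p z * push X (Q z) R y) X" if "z \<in> X" for z
      by (intro has_sum_cmult_right has_sum_push[OF QD(1) R] that y)
    show "((\<lambda>z. p z * push X (Q z) R y) has_sum push X p (\<lambda>z. push X (Q z) R) y) X"
      by (rule has_sum_push[OF p QR y])
  qed (use pD QD RD y in auto)
  moreover have "(\<Sum>\<^sub>\<infinity>z\<in>X. p z * (Q z w * R w y)) = push X p Q w * R w y" for w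
    unfolding push_def by (simp add: mult.assoc flip: infsum_cmult_left')
  ultimately have "((\<lambda>w. push X p Q w * R w y) has_sum push X p (\<lambda>z. push X (Q z) R) y) X"
    by simp
  then show ?thesis
    unfolding push_def[of X "push X p Q"] by (rule infsumI)
qed

lemma has_sum_id_matrix:
  assumes "x \<in> X"
  shows "(id_matrix x has_sum 1) X"
  by (rule has_sum_finite_neutralI[where B = "{x}"]) (use assms in \<open>auto simp: id_matrix_def\<close>)

lemma push_id_matrix:
  assumes "y \<in> X"
  shows "push X p id_matrix y = p y"
proof -
  have "((\<lambda>z. p z * id_matrix z y) has_sum p y) X"
    by (rule has_sum_finite_neutralI[where B = "{y}"]) (use assms in \<open>auto simp: id_matrix_def\<close>)
  then show ?thesis
    unfolding push_def by (rule infsumI)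
qed

lemma stochastic_matrix_power:
  assumes "stochastic_matrix X K"
  shows "stochastic_matrix X (matrix_power X K m)"
proof (induction m)
  case 0
  show ?case
    by (simp add: stochastic_matrix_def probability_on_def has_sum_id_matrix) (simp add: id_matrix_def)
next
  case (Suc m)
  then show ?case
    using probability_on_push assms
    unfolding stochastic_matrix_def matrix_power_Suc_push by blast
qed

lemma push_matrix_power_Suc:
  assumes p: "probability_on X p" and K: "stochastic_matrix X K" and y: "y \<in> X"
  shows "push X p (matrix_power X K (Suc m)) y = push X (push X p (matrix_power X K m)) K y"
  using push_push[OF p stochastic_matrix_power[OF K] K y]
  by (simp add: push_def matrix_mult_def)

lemma matrix_power_add:
  assumes K: "stochastic_matrix X K" and x: "x \<in> X" and y: "y \<in> X"
  shows "matrix_power X K (i + j) x y = push X (matrix_power X K i x) (matrix_power X K j) y"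
  using y
proof (induction j arbitrary: y)
  case 0
  then show ?case by (simp add: push_id_matrix)
next
  case (Suc j)
  note p = stochastic_matrixD(1)[OF stochastic_matrix_power[OF K] x]
  have "matrix_power X K (i + Suc j) x y = push X (matrix_power X K (i + j) x) K y"
    unfolding add_Suc_right matrix_power_Suc_push ..
  also have "\<dots> = push X (push X (matrix_power X K i x) (matrix_power X K j)) K y"
    by (intro push_cong refl Suc.IH)
  also have "\<dots> = push X (matrix_power X K i x) (matrix_power X K (Suc j)) y"
    by (simp only: push_matrix_power_Suc[OF p K Suc.prems])
  finally show ?case .
qed

lemma stationary_push:
  assumes "stationary_probability X K \<pi>" "y \<in> X"
  shows "push X \<pi> K y = \<pi> y"
  unfolding push_def using assms by (auto simp: stationary_probability_def intro: infsumI)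

lemma stationary_push_matrix_power:
  assumes K: "stochastic_matrix X K" and st: "stationary_probability X K \<pi>" and y: "y \<in> X"
  shows "push X \<pi> (matrix_power X K m) y = \<pi> y"
  using y
proof (induction m arbitrary: y)
  case 0
  then show ?case by (simp add: push_id_matrix)
next
  case (Suc m)
  have "push X \<pi> (matrix_power X K (Suc m)) y = push X (push X \<pi> (matrix_power X K m)) K y"
    using st K Suc.prems by (intro push_matrix_power_Suc) (simp_all add: stationary_probability_def)
  also have "\<dots> = push X \<pi> K y"
    by (intro push_cong refl Suc.IH)
  finally show ?case
    using stationary_push[OF st Suc.prems] by simp
qed

section \<open>Affinities and data processing\<close>

text \<open>
  An affinity measures how much two mass distributions have in common, pointwise in the masses.
  Homogeneity and superadditivity together say that \<open>\<phi>\<close> is concave, so that merging masses can only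
  increase the total affinity.  The minimum and the geometric mean are the instances behind the
  total variation and the Hellinger distance.
\<close>

locale affinity =
  fixes \<phi> :: "real \<Rightarrow> real \<Rightarrow> real"
  assumes nonneg: "0 \<le> a \<Longrightarrow> 0 \<le> b \<Longrightarrow> 0 \<le> \<phi> a b"
    and mono: "0 \<le> a \<Longrightarrow> 0 \<le> b \<Longrightarrow> a \<le> a' \<Longrightarrow> b \<le> b' \<Longrightarrow> \<phi> a b \<le> \<phi> a' b'"
    and homogeneous: "0 \<le> a \<Longrightarrow> 0 \<le> b \<Longrightarrow> 0 \<le> c \<Longrightarrow> \<phi> (a * c) (b * c) = \<phi> a b * c"
    and superadditive: "0 \<le> a \<Longrightarrow> 0 \<le> b \<Longrightarrow> 0 \<le> a' \<Longrightarrow> 0 \<le> b' \<Longrightarrow>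
      \<phi> a b + \<phi> a' b' \<le> \<phi> (a + a') (b + b')"
begin

lemma zero: "\<phi> 0 0 = 0"
  using homogeneous[of 0 0 0] by simp

lemma sum_le:
  assumes "finite F" "\<And>z. z \<in> F \<Longrightarrow> 0 \<le> a z" "\<And>z. z \<in> F \<Longrightarrow> 0 \<le> b z"
  shows "(\<Sum>z\<in>F. \<phi> (a z) (b z)) \<le> \<phi> (sum a F) (sum b F)"
  using assms
proof (induction F)
  case (insert x F)
  then have "(\<Sum>z\<in>insert x F. \<phi> (a z) (b z)) \<le> \<phi> (a x) (b x) + \<phi> (sum a F) (sum b F)"
    by simp
  also have "\<dots> \<le> \<phi> (a x + sum a F) (b x + sum b F)"
    using insert by (intro superadditive sum_nonneg) auto
  finally show ?case
    using insert by simp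
qed (simp add: zero)

lemma
  assumes a: "(a has_sum \<alpha>) X" "\<And>z. z \<in> X \<Longrightarrow> 0 \<le> a z"
    and b: "(b has_sum \<beta>) X" "\<And>z. z \<in> X \<Longrightarrow> 0 \<le> b z"
  shows summable: "(\<lambda>z. \<phi> (a z) (b z)) summable_on X"
    and infsum_le: "(\<Sum>\<^sub>\<infinity>z\<in>X. \<phi> (a z) (b z)) \<le> \<phi> \<alpha> \<beta>"
proof -
  have bound: "(\<Sum>z\<in>F. \<phi> (a z) (b z)) \<le> \<phi> \<alpha> \<beta>" if "finite F" "F \<subseteq> X" for F
  proof -
    have "(\<Sum>z\<in>F. \<phi> (a z) (b z)) \<le> \<phi> (sum a F) (sum b F)"
      using that a b by (intro sum_le) auto
    also have "\<dots> \<le> \<phi> \<alpha> \<beta>"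
      using that a b by (intro mono sum_nonneg finite_sum_le_has_sum[where A = X]) auto
    finally show ?thesis .
  qed
  show sm: "(\<lambda>z. \<phi> (a z) (b z)) summable_on X"
    by (rule nonneg_bdd_above_summable_on)
      (use a b bound in \<open>auto intro!: nonneg bdd_aboveI[where M = "\<phi> \<alpha> \<beta>"]\<close>)
  show "(\<Sum>\<^sub>\<infinity>z\<in>X. \<phi> (a z) (b z)) \<le> \<phi> \<alpha> \<beta>"
    by (rule infsum_le_finite_sums[OF sm bound])
qed

text \<open>
  By homogeneity, a transition matrix with rows of sum 1 splits the affinity at a state \<open>z\<close> over
  the targets \<open>y\<close> without changing the total; collecting at each \<open>y\<close> the pieces coming from all
  \<open>z\<close> then increases the affinity, by superadditivity for infinitely many summands.
\<close>

lemma data_processing: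
  assumes p: "probability_on X p" and q: "probability_on X q" and Q: "stochastic_matrix X Q"
  shows "(\<Sum>\<^sub>\<infinity>z\<in>X. \<phi> (p z) (q z)) \<le> (\<Sum>\<^sub>\<infinity>y\<in>X. \<phi> (push X p Q y) (push X q Q y))"
proof -
  note pD = probability_onD[OF p] and qD = probability_onD[OF q] and QD = stochastic_matrixD[OF Q]
  note pQ = probability_onD[OF probability_on_push[OF p Q]]
    and qQ = probability_onD[OF probability_on_push[OF q Q]]
  \<comment> \<open>The affinity of the masses that move from z to y.\<close>
  let ?f = "\<lambda>z y. \<phi> (p z * Q z y) (q z * Q z y)"
  have "((\<lambda>y. \<Sum>\<^sub>\<infinity>z\<in>X. ?f z y) has_sum (\<Sum>\<^sub>\<infinity>z\<in>X. \<phi> (p z) (q z))) X"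
  proof (rule has_sum_swap_nonneg(1))
    show "(?f z has_sum \<phi> (p z) (q z)) X" if "z \<in> X" for z
    proof -
      have "((\<lambda>y. \<phi> (p z) (q z) * Q z y) has_sum \<phi> (p z) (q z)) X"
        using has_sum_cmult_right[OF QD(3)[OF that]] by force
      then show ?thesis
        by (rule has_sum_cong[THEN iffD1, rotated])
          (use homogeneous pD qD QD that in auto)
    qed
    show "((\<lambda>z. \<phi> (p z) (q z)) has_sum (\<Sum>\<^sub>\<infinity>z\<in>X. \<phi> (p z) (q z))) X"
      by (intro has_sum_infsum summable) (use pD qD in auto)
  qed (use pD qD QD nonneg in auto)
  moreover have "((\<lambda>y. \<phi> (push X p Q y) (push X q Q y)) has_sum
      (\<Sum>\<^sub>\<infinity>y\<in>X. \<phi> (push X p Q y) (push X q Q y))) X"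
    by (intro has_sum_infsum summable) (use pQ qQ in auto)
  moreover have "(\<Sum>\<^sub>\<infinity>z\<in>X. ?f z y) \<le> \<phi> (push X p Q y) (push X q Q y)" if "y \<in> X" for y
    by (rule infsum_le) (use has_sum_push[OF p Q that] has_sum_push[OF q Q that] pD qD QD that in auto)
  ultimately show ?thesis
    by (rule has_sum_mono)
qed

end

interpretation minimum: affinity "\<lambda>a b. min a b"
  by unfold_locales (auto simp: min_mult_distrib_right)

interpretation geometric_mean: affinity "\<lambda>a b. sqrt (a * b)"
proof
  fix a b a' b' :: real
  assume nn: "0 \<le> a" "0 \<le> b" "0 \<le> a'" "0 \<le> b'"
  \<comment> \<open>After squaring, the claim is the arithmetic-geometric mean inequality for the cross terms.\<close>
  have "2 * sqrt ((a * b') * (a' * b)) \<le> a * b' + a' * b"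
    using nn arith_geo_mean_sqrt[of "a * b'" "a' * b"] by simp
  then have "(sqrt (a * b) + sqrt (a' * b'))\<^sup>2 \<le> (a + a') * (b + b')"
    using nn by (simp add: power2_sum algebra_simps flip: real_sqrt_mult)
  then show "sqrt (a * b) + sqrt (a' * b') \<le> sqrt ((a + a') * (b + b'))"
    by (rule real_le_rsqrt)
next
  fix a b c :: real
  assume "0 \<le> a" "0 \<le> b" "0 \<le> c"
  then show "sqrt (a * c * (b * c)) = sqrt (a * b) * c"
    by (simp add: real_sqrt_mult)
qed (auto intro: mult_mono)

definition overlap :: "'a set \<Rightarrow> ('a \<Rightarrow> real) \<Rightarrow> ('a \<Rightarrow> real) \<Rightarrow> real" where
  "overlap X p q = (\<Sum>\<^sub>\<infinity>y\<in>X. min (p y) (q y))"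

definition bhattacharyya :: "'a set \<Rightarrow> ('a \<Rightarrow> real) \<Rightarrow> ('a \<Rightarrow> real) \<Rightarrow> real" where
  "bhattacharyya X p q = (\<Sum>\<^sub>\<infinity>y\<in>X. sqrt (p y * q y))"

context
  fixes X :: "'a set" and p q :: "'a \<Rightarrow> real"
  assumes p: "probability_on X p" and q: "probability_on X q"
begin

lemma has_sum_overlap: "((\<lambda>y. min (p y) (q y)) has_sum overlap X p q) X"
  unfolding overlap_def
  using probability_onD[OF p] probability_onD[OF q] by (intro has_sum_infsum minimum.summable) auto

lemma has_sum_bhattacharyya: "((\<lambda>y. sqrt (p y * q y)) has_sum bhattacharyya X p q) X"
  unfolding bhattacharyya_def
  using probability_onD[OF p] probability_onD[OF q] by (intro has_sum_infsum geometric_mean.summable) auto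

lemma overlap_nonneg: "0 \<le> overlap X p q"
  unfolding overlap_def
  using probability_onD(1)[OF p] probability_onD(1)[OF q] by (intro infsum_nonneg) auto

lemma bhattacharyya_le_1: "bhattacharyya X p q \<le> 1"
  unfolding bhattacharyya_def
  using geometric_mean.infsum_le[where a = p and b = q and \<alpha> = 1 and \<beta> = 1] probability_onD[OF p] probability_onD[OF q] by simp

lemma overlap_le_bhattacharyya: "overlap X p q \<le> bhattacharyya X p q"
proof (rule has_sum_mono[OF has_sum_overlap has_sum_bhattacharyya])
  fix y assume "y \<in> X"
  then have "0 \<le> p y" "0 \<le> q y"
    using probability_onD(1)[OF p] probability_onD(1)[OF q] by auto
  then have "(min (p y) (q y))\<^sup>2 \<le> p y * q y"
    unfolding power2_eq_square by (intro mult_mono) auto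
  then show "min (p y) (q y) \<le> sqrt (p y * q y)"
    by (rule real_le_rsqrt)
qed

text \<open>
  Superadditivity of the geometric mean is the Cauchy-Schwarz inequality.  It is applied to the
  factorization of \<open>p y * q y\<close> into the minimum and the maximum of \<open>p y\<close> and \<open>q y\<close>, whose total
  masses are the overlap and 2 minus the overlap.
\<close>

lemma bhattacharyya_square_le: "(bhattacharyya X p q)\<^sup>2 \<le> overlap X p q * (2 - overlap X p q)"
proof -
  note pD = probability_onD[OF p] and qD = probability_onD[OF q]
  have "((\<lambda>y. p y + q y - min (p y) (q y)) has_sum (1 + 1 - overlap X p q)) X"
    by (intro has_sum_diff has_sum_add pD qD has_sum_overlap)
  moreover have "p y + q y - min (p y) (q y) = max (p y) (q y)" for y
    by (auto simp: min_def max_def)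
  ultimately have "((\<lambda>y. max (p y) (q y)) has_sum (2 - overlap X p q)) X"
    by simp
  then have "(\<Sum>\<^sub>\<infinity>y\<in>X. sqrt (min (p y) (q y) * max (p y) (q y))) \<le>
      sqrt (overlap X p q * (2 - overlap X p q))"
    using pD(1) qD(1) by (intro geometric_mean.infsum_le has_sum_overlap) (auto simp: le_max_iff_disj)
  moreover have "min (p y) (q y) * max (p y) (q y) = p y * q y" for y
    by (auto simp: min_def max_def)
  ultimately have "bhattacharyya X p q \<le> sqrt (overlap X p q * (2 - overlap X p q))"
    by (simp add: bhattacharyya_def)
  moreover have "0 \<le> bhattacharyya X p q"
    using overlap_nonneg overlap_le_bhattacharyya by linarith
  ultimately have "(bhattacharyya X p q)\<^sup>2 \<le> (sqrt (overlap X p q * (2 - overlap X p q)))\<^sup>2"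
    by (rule power_mono)
  moreover have "0 \<le> overlap X p q * (2 - overlap X p q)"
    using overlap_nonneg overlap_le_bhattacharyya bhattacharyya_le_1 by (intro mult_nonneg_nonneg) auto
  ultimately show ?thesis
    by simp
qed

lemma hellinger_bhattacharyya:
  "1 / 2 * (\<Sum>\<^sub>\<infinity>y\<in>X. (sqrt (p y) - sqrt (q y))\<^sup>2) = 1 - bhattacharyya X p q"
proof -
  note pD = probability_onD[OF p] and qD = probability_onD[OF q]
  have "((\<lambda>y. p y + q y - 2 * sqrt (p y * q y)) has_sum (1 + 1 - 2 * bhattacharyya X p q)) X"
    by (intro has_sum_diff has_sum_add has_sum_cmult_right pD qD has_sum_bhattacharyya)
  then have "((\<lambda>y. (sqrt (p y) - sqrt (q y))\<^sup>2) has_sum (1 + 1 - 2 * bhattacharyya X p q)) X"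
    by (rule has_sum_cong[THEN iffD1, rotated])
      (use pD(1) qD(1) in \<open>simp add: power2_diff real_sqrt_mult\<close>)
  then show ?thesis
    by (simp add: infsumI)
qed

text \<open>
  On any event the excess of \<open>p\<close> over \<open>q\<close> is at most the part of \<open>p\<close> lying above the common
  part, summed over all of \<open>X\<close>.
\<close>

lemma event_difference_le:
  assumes "A \<subseteq> X"
  shows "(\<Sum>\<^sub>\<infinity>y\<in>A. p y) - (\<Sum>\<^sub>\<infinity>y\<in>A. q y) \<le> 1 - overlap X p q"
proof -
  note pD = probability_onD[OF p] and qD = probability_onD[OF q]
  have sums: "(p has_sum infsum p A) A" "(q has_sum infsum q A) A"
    using pD qD assms by (auto intro!: has_sum_infsum intro: summable_on_subset_banach has_sum_imp_summable)
  have "((\<lambda>y. p y - q y) has_sum (infsum p A - infsum q A)) A"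
    by (intro has_sum_diff sums)
  moreover have "((\<lambda>y. p y - min (p y) (q y)) has_sum (1 - overlap X p q)) X"
    by (intro has_sum_diff pD has_sum_overlap)
  ultimately show ?thesis
    by (rule has_sum_mono_neutral) (use assms in auto)
qed

text \<open>
  The event where \<open>p\<close> dominates \<open>q\<close> is optimal: it captures exactly the part of \<open>p\<close> above the
  common part.  Thus the total variation distance is 1 minus the overlap.
\<close>

lemma event_difference_eq:
  "(\<Sum>\<^sub>\<infinity>y\<in>{y \<in> X. q y \<le> p y}. p y) - (\<Sum>\<^sub>\<infinity>y\<in>{y \<in> X. q y \<le> p y}. q y) = 1 - overlap X p q"
proof -
  note pD = probability_onD[OF p] and qD = probability_onD[OF q]
  let ?A = "{y \<in> X. q y \<le> p y}"
  have sums: "(p has_sum infsum p ?A) ?A" "(q has_sum infsum q ?A) ?A"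
    using pD qD by (auto intro!: has_sum_infsum intro: summable_on_subset_banach has_sum_imp_summable)
  have "((\<lambda>y. p y - q y) has_sum (infsum p ?A - infsum q ?A)) ?A"
    by (intro has_sum_diff sums)
  moreover have "((\<lambda>y. p y - min (p y) (q y)) has_sum (1 - overlap X p q)) X"
    by (intro has_sum_diff pD has_sum_overlap)
  then have "((\<lambda>y. p y - q y) has_sum (1 - overlap X p q)) ?A"
    by (rule has_sum_cong_neutral[THEN iffD1, rotated 3]) auto
  ultimately show ?thesis
    by (rule has_sum_unique)
qed

end

section \<open>Worst-case distances\<close>

locale markov_kernel =
  fixes X :: "'a set" and P :: "'a \<Rightarrow> 'a \<Rightarrow> real" and \<pi> :: "'a \<Rightarrow> real"
  assumes stochastic: "stochastic_matrix X P" and probability: "probability_on X \<pi>"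
begin

lemma row: "x \<in> X \<Longrightarrow> probability_on X (P x)"
  using stochastic by (simp add: stochastic_matrix_def)

lemma nonempty: "X \<noteq> {}"
  using probability_onD(2)[OF probability] by (auto dest: has_sum_unique[OF has_sum_empty])

definition tv :: "'a \<Rightarrow> real" where "tv x = 1 - overlap X (P x) \<pi>"

definition hellinger :: "'a \<Rightarrow> real" where "hellinger x = sqrt (1 - bhattacharyya X (P x) \<pi>)"

lemma max_tv_dist_eq: "max_tv_dist X P \<pi> = (SUP x\<in>X. tv x)"
proof (rule antisym)
  have bdd: "bdd_above (tv ` X)"
    using overlap_nonneg[OF row probability] by (auto simp: tv_def intro!: bdd_aboveI[where M = 1])
  have le: "(\<Sum>\<^sub>\<infinity>y\<in>A. P x y) - (\<Sum>\<^sub>\<infinity>y\<in>A. \<pi> y) \<le> tv x" if "x \<in> X" "A \<subseteq> X" for x A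
    unfolding tv_def by (rule event_difference_le[OF row[OF that(1)] probability that(2)])
  show "max_tv_dist X P \<pi> \<le> (SUP x\<in>X. tv x)"
    unfolding max_tv_dist_def
  proof (rule cSUP_least)
    fix z assume z: "z \<in> X \<times> Pow X"
    obtain x A where [simp]: "z = (x, A)" by (cases z)
    have "(\<Sum>\<^sub>\<infinity>y\<in>A. P x y) - (\<Sum>\<^sub>\<infinity>y\<in>A. \<pi> y) \<le> tv x"
      using z by (intro le) auto
    also have "\<dots> \<le> (SUP x\<in>X. tv x)"
      using z by (intro cSUP_upper bdd) auto
    finally show "(case z of (x, A) \<Rightarrow> (\<Sum>\<^sub>\<infinity>y\<in>A. P x y) - (\<Sum>\<^sub>\<infinity>y\<in>A. \<pi> y)) \<le> (SUP x\<in>X. tv x)"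
      by simp
  qed (use nonempty in auto)
  show "(SUP x\<in>X. tv x) \<le> max_tv_dist X P \<pi>"
  proof (rule cSUP_least[OF nonempty])
    fix x assume x: "x \<in> X"
    let ?A = "{y \<in> X. \<pi> y \<le> P x y}"
    have "bdd_above ((\<lambda>(x, A). (\<Sum>\<^sub>\<infinity>y\<in>A. P x y) - (\<Sum>\<^sub>\<infinity>y\<in>A. \<pi> y)) ` (X \<times> Pow X))"
    proof (rule bdd_aboveI2[where M = 1])
      fix z assume z: "z \<in> X \<times> Pow X"
      obtain x A where [simp]: "z = (x, A)" by (cases z)
      have "(\<Sum>\<^sub>\<infinity>y\<in>A. P x y) - (\<Sum>\<^sub>\<infinity>y\<in>A. \<pi> y) \<le> tv x"
        using z by (intro le) auto
      also have "tv x \<le> 1"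
        using z overlap_nonneg[OF row probability, of x] by (simp add: tv_def)
      finally show "(case z of (x, A) \<Rightarrow> (\<Sum>\<^sub>\<infinity>y\<in>A. P x y) - (\<Sum>\<^sub>\<infinity>y\<in>A. \<pi> y)) \<le> 1"
        by simp
    qed
    then have "(case (x, ?A) of (x, A) \<Rightarrow> (\<Sum>\<^sub>\<infinity>y\<in>A. P x y) - (\<Sum>\<^sub>\<infinity>y\<in>A. \<pi> y)) \<le> max_tv_dist X P \<pi>"
      unfolding max_tv_dist_def using x by (intro cSUP_upper) auto
    then show "tv x \<le> max_tv_dist X P \<pi>"
      using event_difference_eq[OF row[OF x] probability] by (simp add: tv_def)
  qed
qed

lemma max_hellinger_dist_eq: "max_hellinger_dist X P \<pi> = (SUP x\<in>X. hellinger x)"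
  unfolding max_hellinger_dist_def hellinger_def
  by (intro SUP_cong refl) (simp only: hellinger_bhattacharyya[OF row probability])

lemma tv_bounds: "x \<in> X \<Longrightarrow> 0 \<le> tv x \<and> tv x \<le> 1"
  using overlap_nonneg[OF row probability] overlap_le_bhattacharyya[OF row probability]
    bhattacharyya_le_1[OF row probability]
  by (force simp: tv_def)

lemma hellinger_square: "x \<in> X \<Longrightarrow> (hellinger x)\<^sup>2 = 1 - bhattacharyya X (P x) \<pi>"
  using bhattacharyya_le_1[OF row probability] by (simp add: hellinger_def)

lemma hellinger_bounds: "x \<in> X \<Longrightarrow> 0 \<le> hellinger x \<and> hellinger x \<le> 1"
  using overlap_nonneg[OF row probability] overlap_le_bhattacharyya[OF row probability]
    bhattacharyya_le_1[OF row probability]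
  by (force simp: hellinger_def)

lemma tv_le_max: "x \<in> X \<Longrightarrow> tv x \<le> max_tv_dist X P \<pi>"
  unfolding max_tv_dist_eq
  by (intro cSUP_upper) (use tv_bounds in \<open>auto intro!: bdd_aboveI[where M = 1]\<close>)

lemma hellinger_le_max: "x \<in> X \<Longrightarrow> hellinger x \<le> max_hellinger_dist X P \<pi>"
  unfolding max_hellinger_dist_eq
  by (intro cSUP_upper) (use hellinger_bounds in \<open>auto intro!: bdd_aboveI[where M = 1]\<close>)

lemma max_tv_leI: "(\<And>x. x \<in> X \<Longrightarrow> tv x \<le> c) \<Longrightarrow> max_tv_dist X P \<pi> \<le> c"
  unfolding max_tv_dist_eq using nonempty by (intro cSUP_least)

lemma max_hellinger_leI: "(\<And>x. x \<in> X \<Longrightarrow> hellinger x \<le> c) \<Longrightarrow> max_hellinger_dist X P \<pi> \<le> c"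
  unfolding max_hellinger_dist_eq using nonempty by (intro cSUP_least)

lemma max_tv_bounds: "0 \<le> max_tv_dist X P \<pi>" "max_tv_dist X P \<pi> \<le> 1"
proof -
  obtain x where x: "x \<in> X"
    using nonempty by auto
  show "0 \<le> max_tv_dist X P \<pi>"
    using tv_bounds[OF x] tv_le_max[OF x] by linarith
  show "max_tv_dist X P \<pi> \<le> 1"
    using tv_bounds by (intro max_tv_leI) auto
qed

lemma max_hellinger_bounds: "0 \<le> max_hellinger_dist X P \<pi>" "max_hellinger_dist X P \<pi> \<le> 1"
proof -
  obtain x where x: "x \<in> X"
    using nonempty by auto
  show "0 \<le> max_hellinger_dist X P \<pi>"
    using hellinger_bounds[OF x] hellinger_le_max[OF x] by linarith
  show "max_hellinger_dist X P \<pi> \<le> 1"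
    using hellinger_bounds by (intro max_hellinger_leI) auto
qed

text \<open>
  Both this inequality and the next hold state by state and survive the supremum because each bound
  is increasing in the distance on its right-hand side.
\<close>

lemma max_hellinger_square_le_max_tv: "(max_hellinger_dist X P \<pi>)\<^sup>2 \<le> max_tv_dist X P \<pi>"
proof -
  have "max_hellinger_dist X P \<pi> \<le> sqrt (max_tv_dist X P \<pi>)"
  proof (rule max_hellinger_leI)
    fix x assume x: "x \<in> X"
    have "(hellinger x)\<^sup>2 \<le> tv x"
      using overlap_le_bhattacharyya[OF row[OF x] probability]
      by (simp add: hellinger_square[OF x] tv_def)
    also have "\<dots> \<le> max_tv_dist X P \<pi>"
      by (rule tv_le_max[OF x])
    finally show "hellinger x \<le> sqrt (max_tv_dist X P \<pi>)"
      by (rule real_le_rsqrt)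
  qed
  then have "(max_hellinger_dist X P \<pi>)\<^sup>2 \<le> (sqrt (max_tv_dist X P \<pi>))\<^sup>2"
    using max_hellinger_bounds by (intro power_mono) auto
  then show ?thesis
    using max_tv_bounds by simp
qed

lemma max_tv_square_le:
  "(max_tv_dist X P \<pi>)\<^sup>2 \<le> 1 - (1 - (max_hellinger_dist X P \<pi>)\<^sup>2)\<^sup>2"
proof -
  let ?h = "max_hellinger_dist X P \<pi>"
  have h: "0 \<le> 1 - ?h\<^sup>2" "1 - ?h\<^sup>2 \<le> 1"
    using max_hellinger_bounds by (auto simp: power_le_one)
  then have "(1 - ?h\<^sup>2)\<^sup>2 \<le> 1"
    by (rule power_le_one)
  then have nonneg: "0 \<le> 1 - (1 - ?h\<^sup>2)\<^sup>2"
    by simp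
  have "max_tv_dist X P \<pi> \<le> sqrt (1 - (1 - ?h\<^sup>2)\<^sup>2)"
  proof (rule max_tv_leI)
    fix x assume x: "x \<in> X"
    have "(tv x)\<^sup>2 = 1 - overlap X (P x) \<pi> * (2 - overlap X (P x) \<pi>)"
      by (simp add: tv_def power2_eq_square algebra_simps)
    also have "\<dots> \<le> 1 - (bhattacharyya X (P x) \<pi>)\<^sup>2"
      using bhattacharyya_square_le[OF row[OF x] probability] by simp
    also have "\<dots> = 1 - (1 - (hellinger x)\<^sup>2)\<^sup>2"
      by (simp add: hellinger_square[OF x])
    also have "(hellinger x)\<^sup>2 \<le> ?h\<^sup>2"
      using hellinger_bounds[OF x] hellinger_le_max[OF x] by (intro power_mono) auto
    then have "(1 - ?h\<^sup>2)\<^sup>2 \<le> (1 - (hellinger x)\<^sup>2)\<^sup>2"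
      by (intro power_mono h) simp
    then have "1 - (1 - (hellinger x)\<^sup>2)\<^sup>2 \<le> 1 - (1 - ?h\<^sup>2)\<^sup>2"
      by simp
    finally show "tv x \<le> sqrt (1 - (1 - ?h\<^sup>2)\<^sup>2)"
      by (rule real_le_rsqrt)
  qed
  then have "(max_tv_dist X P \<pi>)\<^sup>2 \<le> (sqrt (1 - (1 - ?h\<^sup>2)\<^sup>2))\<^sup>2"
    using max_tv_bounds by (intro power_mono) auto
  then show ?thesis
    using nonneg by simp
qed

text \<open>
  \<open>P'\<close> is the product \<open>P Q\<close>, and \<open>Q\<close> leaves \<open>\<pi>\<close> invariant.  It is specified only on
  \<open>X \<times> X\<close>, where the semigroup law for the heat kernel is available.
\<close>

context
  fixes Q P' :: "'a \<Rightarrow> 'a \<Rightarrow> real"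
  assumes Q: "stochastic_matrix X Q"
    and stationary: "\<And>y. y \<in> X \<Longrightarrow> push X \<pi> Q y = \<pi> y"
    and P': "\<And>x y. x \<in> X \<Longrightarrow> y \<in> X \<Longrightarrow> P' x y = push X (P x) Q y"
begin

lemma markov_kernel_push: "markov_kernel X P' \<pi>"
proof
  have "probability_on X (P' x)" if "x \<in> X" for x
    using probability_on_push[OF row[OF that] Q] has_sum_cong[of X "P' x" "push X (P x) Q"]
    by (simp add: probability_on_def P' that)
  then show "stochastic_matrix X P'"
    by (simp add: stochastic_matrix_def)
qed (rule probability)

lemma max_tv_dist_push: "max_tv_dist X P' \<pi> \<le> max_tv_dist X P \<pi>"
proof -
  interpret P': markov_kernel X P' \<pi> by (rule markov_kernel_push)
  show ?thesis
  proof (rule P'.max_tv_leI)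
    fix x assume x: "x \<in> X"
    have "overlap X (P x) \<pi> \<le> overlap X (push X (P x) Q) (push X \<pi> Q)"
      unfolding overlap_def by (rule minimum.data_processing[OF row[OF x] probability Q])
    also have "\<dots> = overlap X (P' x) \<pi>"
      unfolding overlap_def by (intro infsum_cong) (simp add: P' stationary x)
    finally show "P'.tv x \<le> max_tv_dist X P \<pi>"
      using tv_le_max[OF x] by (simp add: tv_def P'.tv_def)
  qed
qed

lemma max_hellinger_dist_push: "max_hellinger_dist X P' \<pi> \<le> max_hellinger_dist X P \<pi>"
proof -
  interpret P': markov_kernel X P' \<pi> by (rule markov_kernel_push)
  show ?thesis
  proof (rule P'.max_hellinger_leI)
    fix x assume x: "x \<in> X"
    have "bhattacharyya X (P x) \<pi> \<le> bhattacharyya X (push X (P x) Q) (push X \<pi> Q)"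
      unfolding bhattacharyya_def by (rule geometric_mean.data_processing[OF row[OF x] probability Q])
    also have "\<dots> = bhattacharyya X (P' x) \<pi>"
      unfolding bhattacharyya_def by (intro infsum_cong) (simp add: P' stationary x)
    finally have "P'.hellinger x \<le> hellinger x"
      by (simp add: hellinger_def P'.hellinger_def)
    then show "P'.hellinger x \<le> max_hellinger_dist X P \<pi>"
      using hellinger_le_max[OF x] by linarith
  qed
qed

end

end

section \<open>The heat kernel\<close>

definition poisson :: "real \<Rightarrow> nat \<Rightarrow> real" where
  "poisson t i = exp (- t) * (t ^ i / fact i)"

lemma poisson_nonneg: "0 \<le> t \<Longrightarrow> 0 \<le> poisson t i"
  by (simp add: poisson_def)

lemma has_sum_poisson:
  assumes "0 \<le> t"
  shows "(poisson t has_sum 1) UNIV"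
proof -
  have "(\<lambda>i. t ^ i / fact i) sums exp t"
    using exp_converges[of t] by (simp add: divide_inverse mult.commute)
  from sums_mult[OF this, of "exp (- t)"] have "poisson t sums 1"
    by (simp add: poisson_def[abs_def] flip: exp_add)
  then show ?thesis
    by (rule sums_nonneg_imp_has_sum) (rule poisson_nonneg[OF assms])
qed

lemma poisson_convolution: "(\<Sum>i\<le>k. poisson t i * poisson s (k - i)) = poisson (t + s) k"
proof -
  have "(t + s) ^ k / fact k = (\<Sum>i\<le>k. (t ^ i / fact i) * (s ^ (k - i) / fact (k - i)))"
    unfolding binomial_ring sum_divide_distrib
  proof (intro sum.cong refl)
    fix i assume "i \<in> {..k}"
    then have "of_nat (k choose i) = (fact k / (fact i * fact (k - i)) :: real)"
      by (intro binomial_fact) simp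
    then show "of_nat (k choose i) * t ^ i * s ^ (k - i) / fact k =
        (t ^ i / fact i) * (s ^ (k - i) / fact (k - i))"
      by simp
  qed
  moreover have "exp (- (t + s)) = exp (- t) * exp (- s)"
    by (simp flip: exp_add)
  ultimately have "poisson (t + s) k =
      exp (- t) * exp (- s) * (\<Sum>i\<le>k. (t ^ i / fact i) * (s ^ (k - i) / fact (k - i)))"
    by (simp only: poisson_def)
  also have "\<dots> = (\<Sum>i\<le>k. poisson t i * poisson s (k - i))"
    unfolding sum_distrib_left by (intro sum.cong refl) (simp add: poisson_def)
  finally show ?thesis ..
qed


lemma has_sum_sum:
  fixes f :: "'i \<Rightarrow> 'a \<Rightarrow> real"
  assumes "\<And>i. i \<in> I \<Longrightarrow> (f i has_sum s i) A"
  shows "((\<lambda>z. \<Sum>i\<in>I. f i z) has_sum (\<Sum>i\<in>I. s i)) A"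
  using assms by (induction I rule: infinite_finite_induct) (auto intro: has_sum_add)

text \<open>
  The binomial theorem for the commuting matrices \<open>t K\<close> and \<open>- t I\<close>, proved entrywise by Pascal's
  rule.
\<close>

lemma matrix_power_generator:
  assumes K: "stochastic_matrix X K" and x: "x \<in> X" and y: "y \<in> X"
  shows "matrix_power X (\<lambda>x y. - t * (id_matrix x y - K x y)) j x y =
    (\<Sum>i\<le>j. of_nat (j choose i) * t ^ i * (- t) ^ (j - i) * matrix_power X K i x y)"
  using y
proof (induction j arbitrary: y)
  case (Suc j)
  let ?A = "\<lambda>x y. - t * (id_matrix x y - K x y)"
  let ?k = "\<lambda>i. matrix_power X K i x y"
  let ?c = "\<lambda>i. of_nat (j choose i) * t ^ i * (- t) ^ (j - i)"
  have "((\<lambda>z. \<Sum>i\<le>j. ?c i * (t * (matrix_power X K i x z * K z y) + (- t) * (matrix_power X K i x z * id_matrix z y)))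
      has_sum (\<Sum>i\<le>j. ?c i * (t * ?k (Suc i) + (- t) * ?k i))) X"
  proof (intro has_sum_sum has_sum_cmult_right has_sum_add)
    fix i
    note p = stochastic_matrixD(1)[OF stochastic_matrix_power[OF K] x]
    show "((\<lambda>z. matrix_power X K i x z * K z y) has_sum ?k (Suc i)) X"
      unfolding matrix_power_Suc_push by (rule has_sum_push[OF p K Suc.prems])
    have "stochastic_matrix X id_matrix"
      using stochastic_matrix_power[OF K, of 0] by simp
    from has_sum_push[OF p this Suc.prems]
    show "((\<lambda>z. matrix_power X K i x z * id_matrix z y) has_sum ?k i) X"
      by (simp add: push_id_matrix[OF Suc.prems])
  qed
  then have "((\<lambda>z. matrix_power X ?A j x z * ?A z y)
      has_sum (\<Sum>i\<le>j. ?c i * (t * ?k (Suc i) + (- t) * ?k i))) X"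
  proof (rule has_sum_cong[THEN iffD1, rotated])
    fix z assume z: "z \<in> X"
    show "(\<Sum>i\<le>j. ?c i * (t * (matrix_power X K i x z * K z y) + (- t) * (matrix_power X K i x z * id_matrix z y)))
        = matrix_power X ?A j x z * ?A z y"
      unfolding Suc.IH[OF z] sum_distrib_right
      by (intro sum.cong refl) (simp add: algebra_simps)
  qed
  then have "matrix_power X ?A (Suc j) x y = (\<Sum>i\<le>j. ?c i * (t * ?k (Suc i) + (- t) * ?k i))"
    by (simp add: matrix_mult_def infsumI)
  also have "\<dots> = (\<Sum>i\<le>j. of_nat (j choose i) * t ^ Suc i * (- t) ^ (j - i) * ?k (Suc i)) +
      (\<Sum>i\<le>j. of_nat (j choose i) * t ^ i * (- t) ^ (Suc j - i) * ?k i)"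
    unfolding sum.distrib[symmetric]
    by (intro sum.cong refl) (simp add: Suc_diff_le algebra_simps)
  \<comment> \<open>The added term vanishes; it lets the sum be split at the index 0 and shifted.\<close>
  also have "(\<Sum>i\<le>j. of_nat (j choose i) * t ^ i * (- t) ^ (Suc j - i) * ?k i) =
      (\<Sum>i\<le>Suc j. of_nat (j choose i) * t ^ i * (- t) ^ (Suc j - i) * ?k i)"
    by (simp add: binomial_eq_0)
  also have "\<dots> = (- t) ^ Suc j * ?k 0 +
      (\<Sum>i\<le>j. of_nat (j choose Suc i) * t ^ Suc i * (- t) ^ (j - i) * ?k (Suc i))"
    by (subst sum.atMost_Suc_shift) simp
  also have "(\<Sum>i\<le>j. of_nat (j choose i) * t ^ Suc i * (- t) ^ (j - i) * ?k (Suc i)) +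
      ((- t) ^ Suc j * ?k 0 +
       (\<Sum>i\<le>j. of_nat (j choose Suc i) * t ^ Suc i * (- t) ^ (j - i) * ?k (Suc i))) =
      (- t) ^ Suc j * ?k 0 +
       (\<Sum>i\<le>j. of_nat (Suc j choose Suc i) * t ^ Suc i * (- t) ^ (j - i) * ?k (Suc i))"
    by (simp add: algebra_simps sum.distrib)
  also have "\<dots> = (\<Sum>i\<le>Suc j. of_nat (Suc j choose i) * t ^ i * (- t) ^ (Suc j - i) * ?k i)"
    by (subst sum.atMost_Suc_shift) simp
  finally show ?case .
qed simp

text \<open>
  Divided by the factorial, the binomial expansion is the Cauchy product of the exponential series
  of \<open>t K\<close> and of \<open>- t\<close>.  Hence \<open>H\<^sub>t\<close> is \<open>K\<close> run for a Poisson number of steps, which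
  replaces an alternating series by a nonnegative one.
\<close>

lemma has_sum_heat_kernel:
  assumes K: "stochastic_matrix X K" and x: "x \<in> X" and y: "y \<in> X" and t: "0 \<le> t"
  shows "((\<lambda>i. poisson t i * matrix_power X K i x y) has_sum heat_kernel X K t x y) UNIV"
proof -
  let ?k = "\<lambda>i. matrix_power X K i x y"
  let ?a = "\<lambda>i. t ^ i / fact i * ?k i" and ?b = "\<lambda>i. (- t) ^ i / fact i"
  have k: "0 \<le> ?k i" "?k i \<le> 1" for i
    using stochastic_matrixD(2)[OF stochastic_matrix_power[OF K] x y]
      stochastic_matrix_le_1[OF stochastic_matrix_power[OF K] x y] by auto
  have exp_series: "(\<lambda>i. u ^ i / fact i) sums exp u" for u :: real
    using exp_converges[of u] by (simp add: divide_inverse mult.commute)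
  have abs_a: "summable (\<lambda>i. norm (?a i))"
  proof (rule summable_comparison_test')
    show "summable (\<lambda>i. t ^ i / fact i)"
      using exp_series by (rule sums_summable)
    show "norm (norm (?a i)) \<le> t ^ i / fact i" if "0 \<le> i" for i
      using k[of i] t by (simp add: abs_mult divide_right_mono mult_left_le)
  qed
  have abs_b: "summable (\<lambda>i. norm (?b i))"
    using sums_summable[OF exp_series[of t]] t by (simp add: power_abs)
  have coeff: "matrix_power X (\<lambda>x y. - t * (id_matrix x y - K x y)) j x y / fact j =
      (\<Sum>i\<le>j. ?a i * ?b (j - i))" for j
    unfolding matrix_power_generator[OF K x y] sum_divide_distrib
  proof (intro sum.cong refl)
    fix i assume "i \<in> {..j}"
    then have "of_nat (j choose i) = (fact j / (fact i * fact (j - i)) :: real)"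
      by (intro binomial_fact) simp
    then show "of_nat (j choose i) * t ^ i * (- t) ^ (j - i) * ?k i / fact j = ?a i * ?b (j - i)"
      by simp
  qed
  have "heat_kernel X K t x y = (\<Sum>i. ?a i) * (\<Sum>i. ?b i)"
    unfolding heat_kernel_def matrix_exp_def Cauchy_product[OF abs_a abs_b] by (simp only: coeff)
  moreover have "(\<Sum>i. ?b i) = exp (- t)"
    using exp_series by (rule sums_unique[symmetric])
  moreover have "?a sums (\<Sum>i. ?a i)"
    using abs_a by (intro summable_sums) (rule summable_norm_cancel)
  from sums_mult[OF this, of "exp (- t)"]
  have "(\<lambda>i. poisson t i * ?k i) sums (exp (- t) * (\<Sum>i. ?a i))"
    by (simp add: poisson_def mult.assoc)
  ultimately have "(\<lambda>i. poisson t i * ?k i) sums heat_kernel X K t x y"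
    by (simp only: mult.commute[of "exp (- t)"])
  then show ?thesis
    by (rule sums_nonneg_imp_has_sum) (simp add: k poisson_nonneg[OF t])
qed

lemma stochastic_heat_kernel:
  assumes K: "stochastic_matrix X K" and t: "0 \<le> t"
  shows "stochastic_matrix X (heat_kernel X K t)"
  unfolding stochastic_matrix_def probability_on_def
proof (intro ballI conjI)
  fix x assume x: "x \<in> X"
  note KD = stochastic_matrixD[OF stochastic_matrix_power[OF K] x]
  show "0 \<le> heat_kernel X K t x y" if "y \<in> X" for y
    by (rule has_sum_nonneg[OF has_sum_heat_kernel[OF K x that t]])
      (simp add: poisson_nonneg[OF t] KD(2) that)
  have "((\<lambda>y. \<Sum>\<^sub>\<infinity>i. poisson t i * matrix_power X K i x y) has_sum 1) X"
  proof (rule has_sum_swap_nonneg(1))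
    show "((\<lambda>y. poisson t i * matrix_power X K i x y) has_sum poisson t i) X" for i
      using has_sum_cmult_right[OF KD(3), of "poisson t i"] by simp
    show "(poisson t has_sum 1) UNIV"
      by (rule has_sum_poisson[OF t])
  qed (simp add: poisson_nonneg[OF t] KD(2))
  then show "(heat_kernel X K t x has_sum 1) X"
    by (rule has_sum_cong[THEN iffD1, rotated])
      (rule infsumI[OF has_sum_heat_kernel[OF K x _ t]])
qed

lemma has_sum_push_heat_kernel:
  assumes p: "probability_on X p" and K: "stochastic_matrix X K" and y: "y \<in> X" and t: "0 \<le> t"
  shows "((\<lambda>i. poisson t i * push X p (matrix_power X K i) y)
    has_sum push X p (heat_kernel X K t) y) UNIV"
proof -
  note pD = probability_onD[OF p] and KD = stochastic_matrixD[OF stochastic_matrix_power[OF K]]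
  have "((\<lambda>i. \<Sum>\<^sub>\<infinity>z\<in>X. p z * (poisson t i * matrix_power X K i z y))
      has_sum push X p (heat_kernel X K t) y) UNIV"
  proof (rule has_sum_swap_nonneg(1))
    show "((\<lambda>i. p z * (poisson t i * matrix_power X K i z y)) has_sum p z * heat_kernel X K t z y) UNIV"
      if "z \<in> X" for z
      by (intro has_sum_cmult_right has_sum_heat_kernel[OF K that y t])
    show "((\<lambda>z. p z * heat_kernel X K t z y) has_sum push X p (heat_kernel X K t) y) X"
      by (rule has_sum_push[OF p stochastic_heat_kernel[OF K t] y])
  qed (simp add: pD KD y poisson_nonneg[OF t])
  moreover have "(\<Sum>\<^sub>\<infinity>z\<in>X. p z * (poisson t i * matrix_power X K i z y)) =
      poisson t i * push X p (matrix_power X K i) y" for i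
    unfolding push_def by (simp add: mult.left_commute flip: infsum_cmult_right')
  ultimately show ?thesis
    by simp
qed

lemma stationary_push_heat_kernel:
  assumes K: "stochastic_matrix X K" and st: "stationary_probability X K \<pi>" and y: "y \<in> X"
    and t: "0 \<le> t"
  shows "push X \<pi> (heat_kernel X K t) y = \<pi> y"
proof -
  have "probability_on X \<pi>"
    using st by (simp add: stationary_probability_def)
  from has_sum_push_heat_kernel[OF this K y t]
  have "((\<lambda>i. \<pi> y * poisson t i) has_sum push X \<pi> (heat_kernel X K t) y) UNIV"
    by (simp add: stationary_push_matrix_power[OF K st y] mult.commute)
  moreover have "((\<lambda>i. \<pi> y * poisson t i) has_sum \<pi> y * 1) UNIV"
    by (intro has_sum_cmult_right has_sum_poisson t)
  ultimately show ?thesis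
    using has_sum_unique by fastforce
qed

text \<open>
  The semigroup law.  Running \<open>i\<close> steps during time \<open>t\<close> and \<open>j\<close> steps during time \<open>s\<close> amounts to
  \<open>i + j\<close> steps, and the total number of steps is again Poisson distributed.
\<close>

lemma heat_kernel_add:
  assumes K: "stochastic_matrix X K" and x: "x \<in> X" and y: "y \<in> X" and t: "0 \<le> t" and s: "0 \<le> s"
  shows "heat_kernel X K (t + s) x y = push X (heat_kernel X K t x) (heat_kernel X K s) y"
proof -
  note Kpow = stochastic_matrix_power[OF K]
  let ?k = "\<lambda>i. matrix_power X K i x y"
  let ?f = "\<lambda>(i, j). poisson t i * (poisson s j * ?k (i + j))"
  let ?S = "push X (heat_kernel X K t x) (heat_kernel X K s) y"
  have k_nonneg: "0 \<le> ?k i" for i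
    by (rule stochastic_matrixD(2)[OF Kpow x y])
  have "(?f has_sum ?S) (UNIV \<times> UNIV)"
  proof -
    have row: "((\<lambda>j. poisson t i * (poisson s j * ?k (i + j))) has_sum
        poisson t i * push X (matrix_power X K i x) (heat_kernel X K s) y) UNIV" for i
      unfolding matrix_power_add[OF K x y]
      by (intro has_sum_cmult_right has_sum_push_heat_kernel[OF stochastic_matrixD(1)[OF Kpow x] K y s])
    have total: "((\<lambda>i. poisson t i * push X (matrix_power X K i x) (heat_kernel X K s) y) has_sum ?S) UNIV"
    proof -
      have "((\<lambda>i. \<Sum>\<^sub>\<infinity>z\<in>X. poisson t i * matrix_power X K i x z * heat_kernel X K s z y) has_sum ?S) UNIV"
      proof (rule has_sum_swap_nonneg(1))
        show "((\<lambda>i. poisson t i * matrix_power X K i x z * heat_kernel X K s z y) has_sum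
            heat_kernel X K t x z * heat_kernel X K s z y) UNIV" if "z \<in> X" for z
          by (intro has_sum_cmult_left has_sum_heat_kernel[OF K x that t])
        show "((\<lambda>z. heat_kernel X K t x z * heat_kernel X K s z y) has_sum ?S) X"
          by (rule has_sum_push[OF stochastic_matrixD(1)[OF stochastic_heat_kernel[OF K t] x]
                stochastic_heat_kernel[OF K s] y])
      qed (simp add: poisson_nonneg[OF t] stochastic_matrixD(2)[OF Kpow x]
          stochastic_matrixD(2)[OF stochastic_heat_kernel[OF K s] _ y])
      then show ?thesis
        by (simp add: push_def mult.assoc flip: infsum_cmult_right')
    qed
    have "?f summable_on UNIV \<times> UNIV"
      by (rule summable_on_SigmaI)
        (use row total k_nonneg poisson_nonneg t s in \<open>auto dest: has_sum_imp_summable\<close>)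
    then show ?thesis
      by (intro has_sum_SigmaI[OF _ total]) (use row in auto)
  qed
  \<comment> \<open>Regroup the pairs (i, j) by their total m = i + j.\<close>
  also have "(?f has_sum ?S) (UNIV \<times> UNIV) \<longleftrightarrow>
      ((\<lambda>(m, i). poisson t i * poisson s (m - i) * ?k m) has_sum ?S) (SIGMA m:UNIV. {..m})"
    by (rule has_sum_reindex_bij_witness[where i = "\<lambda>(m, i). (i, m - i)" and j = "\<lambda>(i, j). (i + j, i)"])
      (auto simp: mult.assoc)
  finally have "((\<lambda>m. \<Sum>i\<le>m. poisson t i * poisson s (m - i) * ?k m) has_sum ?S) UNIV"
    by (rule has_sum_SigmaD) (auto intro: has_sum_finite)
  then have "((\<lambda>m. poisson (t + s) m * ?k m) has_sum ?S) UNIV"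
    by (simp add: poisson_convolution flip: sum_distrib_right)
  then show ?thesis
    using has_sum_heat_kernel[OF K x y, of "t + s"] t s by (auto intro: has_sum_unique)
qed

section \<open>Distances along a chain\<close>

context
  fixes X :: "'a set" and K :: "'a \<Rightarrow> 'a \<Rightarrow> real" and \<pi> :: "'a \<Rightarrow> real"
  assumes chain: "markov_chain X K \<pi>"
begin

lemma chain_stochastic: "stochastic_matrix X K"
  and chain_stationary: "stationary_probability X K \<pi>"
  and chain_probability: "probability_on X \<pi>"
  using chain by (auto simp: markov_chain_def stationary_probability_def)

lemma markov_kernel_power: "markov_kernel X (matrix_power X K m) \<pi>"
  by unfold_locales (rule stochastic_matrix_power[OF chain_stochastic] chain_probability)+

lemma markov_kernel_heat: "0 \<le> t \<Longrightarrow> markov_kernel X (heat_kernel X K t) \<pi>"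
  by unfold_locales (rule stochastic_heat_kernel[OF chain_stochastic] chain_probability | assumption)+

lemma antimono_d_TV: "antimono (d_TV X K \<pi>)"
  unfolding decseq_Suc_iff d_TV_def
  by (intro allI markov_kernel.max_tv_dist_push[OF markov_kernel_power chain_stochastic])
    (auto simp: stationary_push[OF chain_stationary] matrix_power_Suc_push simp del: matrix_power.simps)

lemma antimono_d_H: "antimono (d_H X K \<pi>)"
  unfolding decseq_Suc_iff d_H_def
  by (intro allI markov_kernel.max_hellinger_dist_push[OF markov_kernel_power chain_stochastic])
    (auto simp: stationary_push[OF chain_stationary] matrix_power_Suc_push simp del: matrix_power.simps)

context
  fixes s t :: real
  assumes st: "0 \<le> s" "s \<le> t"
begin

lemma heat_kernel_split:
  "x \<in> X \<Longrightarrow> y \<in> X \<Longrightarrow> heat_kernel X K t x y = push X (heat_kernel X K s x) (heat_kernel X K (t - s)) y"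
  using heat_kernel_add[OF chain_stochastic, of x y s "t - s"] st by simp

lemma dc_TV_decreasing: "dc_TV X K \<pi> t \<le> dc_TV X K \<pi> s"
  unfolding dc_TV_def
  by (rule markov_kernel.max_tv_dist_push[OF markov_kernel_heat[OF st(1)]
        stochastic_heat_kernel[OF chain_stochastic, of "t - s"]])
    (use st in \<open>auto intro: heat_kernel_split stationary_push_heat_kernel[OF chain_stochastic chain_stationary]\<close>)

lemma dc_H_decreasing: "dc_H X K \<pi> t \<le> dc_H X K \<pi> s"
  unfolding dc_H_def
  by (rule markov_kernel.max_hellinger_dist_push[OF markov_kernel_heat[OF st(1)]
        stochastic_heat_kernel[OF chain_stochastic, of "t - s"]])
    (use st in \<open>auto intro: heat_kernel_split stationary_push_heat_kernel[OF chain_stochastic chain_stationary]\<close>)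

end

end

section \<open>Cutoff times and mixing times\<close>

text \<open>
  The two-sided comparison of a total variation distance \<open>D\<close> and a Hellinger distance \<open>h\<close>.  The
  last inequality is the usual \<open>D \<le> h * sqrt (2 - h\<^sup>2)\<close>, written so that \<open>h \<longlonglongrightarrow> 1\<close> can be read off
  from \<open>D \<longlonglongrightarrow> 1\<close>.
\<close>

definition comparable_distances :: "real \<Rightarrow> real \<Rightarrow> bool" where
  "comparable_distances D h \<longleftrightarrow>
    0 \<le> D \<and> D \<le> 1 \<and> 0 \<le> h \<and> h \<le> 1 \<and> h\<^sup>2 \<le> D \<and> D\<^sup>2 \<le> 1 - (1 - h\<^sup>2)\<^sup>2"

lemma (in markov_kernel) comparable_max_dists:
  "comparable_distances (max_tv_dist X P \<pi>) (max_hellinger_dist X P \<pi>)"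
  unfolding comparable_distances_def
  using max_tv_bounds max_hellinger_bounds max_hellinger_square_le_max_tv max_tv_square_le by blast

text \<open>
  Cutoff refers only to the limit values 0 and 1, and at these the two-sided comparison is tight.
\<close>

lemma
  assumes comparable: "\<forall>\<^sub>F n in sequentially. comparable_distances (D n) (h n)"
  shows comparable_tendsto_0: "D \<longlonglongrightarrow> 0 \<longleftrightarrow> h \<longlonglongrightarrow> 0"
    and comparable_tendsto_1: "D \<longlonglongrightarrow> 1 \<longleftrightarrow> h \<longlonglongrightarrow> 1"
proof -
  have nonneg: "\<forall>\<^sub>F n in sequentially. 0 \<le> D n" "\<forall>\<^sub>F n in sequentially. 0 \<le> h n"
    and le_1: "\<forall>\<^sub>F n in sequentially. D n \<le> 1" "\<forall>\<^sub>F n in sequentially. h n \<le> 1"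
    and square: "\<forall>\<^sub>F n in sequentially. (h n)\<^sup>2 \<le> D n"
    using comparable by (auto elim!: eventually_mono simp: comparable_distances_def)
  show "D \<longlonglongrightarrow> 0 \<longleftrightarrow> h \<longlonglongrightarrow> 0"
  proof
    assume "D \<longlonglongrightarrow> 0"
    from tendsto_real_sqrt[OF this] have "(\<lambda>n. sqrt (D n)) \<longlonglongrightarrow> 0"
      by simp
    moreover have "\<forall>\<^sub>F n in sequentially. h n \<le> sqrt (D n)"
      using square by eventually_elim (rule real_le_rsqrt)
    ultimately show "h \<longlonglongrightarrow> 0"
      by (rule tendsto_sandwich[OF nonneg(2) _ tendsto_const, rotated])
  next
    assume "h \<longlonglongrightarrow> 0"
    then have "(\<lambda>n. sqrt (1 - (1 - (h n)\<^sup>2)\<^sup>2)) \<longlonglongrightarrow> sqrt (1 - (1 - 0\<^sup>2)\<^sup>2)"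
      by (intro tendsto_intros)
    then have "(\<lambda>n. sqrt (1 - (1 - (h n)\<^sup>2)\<^sup>2)) \<longlonglongrightarrow> 0"
      by simp
    moreover have "\<forall>\<^sub>F n in sequentially. D n \<le> sqrt (1 - (1 - (h n)\<^sup>2)\<^sup>2)"
      using comparable by eventually_elim (auto intro: real_le_rsqrt simp: comparable_distances_def)
    ultimately show "D \<longlonglongrightarrow> 0"
      by (rule tendsto_sandwich[OF nonneg(1) _ tendsto_const, rotated])
  qed
  show "D \<longlonglongrightarrow> 1 \<longleftrightarrow> h \<longlonglongrightarrow> 1"
  proof
    assume "D \<longlonglongrightarrow> 1"
    then have "(\<lambda>n. 1 - sqrt (1 - (D n)\<^sup>2)) \<longlonglongrightarrow> 1 - sqrt (1 - 1\<^sup>2)"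
      by (intro tendsto_intros)
    then have "(\<lambda>n. 1 - sqrt (1 - (D n)\<^sup>2)) \<longlonglongrightarrow> 1"
      by simp
    moreover have "\<forall>\<^sub>F n in sequentially. 1 - sqrt (1 - (D n)\<^sup>2) \<le> h n"
      using comparable
    proof eventually_elim
      case (elim n)
      then have h: "0 \<le> h n" "h n \<le> 1" and "(1 - (h n)\<^sup>2)\<^sup>2 \<le> 1 - (D n)\<^sup>2"
        by (auto simp: comparable_distances_def)
      then have "1 - (h n)\<^sup>2 \<le> sqrt (1 - (D n)\<^sup>2)"
        by (intro real_le_rsqrt)
      moreover have "(h n)\<^sup>2 \<le> h n"
        using h by (simp add: power2_eq_square mult_left_le)
      ultimately show ?case
        by linarith
    qed
    ultimately show "h \<longlonglongrightarrow> 1"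
      by (rule tendsto_sandwich[OF _ le_1(2) _ tendsto_const, rotated])
  next
    assume "h \<longlonglongrightarrow> 1"
    from tendsto_power[OF this, of 2] have "(\<lambda>n. (h n)\<^sup>2) \<longlonglongrightarrow> 1"
      by simp
    then show "D \<longlonglongrightarrow> 1"
      by (rule tendsto_sandwich[OF square le_1(1) _ tendsto_const])
  qed
qed

definition cutoff_times :: "(nat \<Rightarrow> nat \<Rightarrow> real) \<Rightarrow> (nat \<Rightarrow> real) \<Rightarrow> bool" where
  "cutoff_times d t \<longleftrightarrow> (\<forall>n\<ge>1. 0 < t n) \<and>
     (\<forall>a>1. (\<lambda>n. d n (nat \<lceil>a * t n\<rceil>)) \<longlonglongrightarrow> 0) \<and>
     (\<forall>a. 0 < a \<and> a < 1 \<longrightarrow> (\<lambda>n. d n (nat \<lfloor>a * t n\<rfloor>)) \<longlonglongrightarrow> 1)"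

definition cutoff_times_c :: "(nat \<Rightarrow> real \<Rightarrow> real) \<Rightarrow> (nat \<Rightarrow> real) \<Rightarrow> bool" where
  "cutoff_times_c d t \<longleftrightarrow> (\<forall>n\<ge>1. 0 < t n) \<and>
     (\<forall>a>1. (\<lambda>n. d n (a * t n)) \<longlonglongrightarrow> 0) \<and>
     (\<forall>a. 0 < a \<and> a < 1 \<longrightarrow> (\<lambda>n. d n (a * t n)) \<longlonglongrightarrow> 1)"

lemma cutoff_iff: "cutoff d \<longleftrightarrow> (\<exists>t. cutoff_times d t)"
  by (simp add: cutoff_def cutoff_times_def)

lemma cutoff_c_iff: "cutoff_c d \<longleftrightarrow> (\<exists>t. cutoff_times_c d t)"
  by (simp add: cutoff_c_def cutoff_times_c_def)

lemma cutoff_times_comparable: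
  assumes "\<And>n m. 1 \<le> n \<Longrightarrow> comparable_distances (D n m) (h n m)"
  shows "cutoff_times D t \<longleftrightarrow> cutoff_times h t"
proof -
  have ev: "\<forall>\<^sub>F n in sequentially. comparable_distances (D n (m n)) (h n (m n))" for m
    using eventually_ge_at_top[of 1] by eventually_elim (rule assms)
  show ?thesis
    unfolding cutoff_times_def
    by (intro conj_cong refl all_cong1 imp_cong comparable_tendsto_0[OF ev] comparable_tendsto_1[OF ev])
qed

lemma cutoff_times_c_comparable:
  assumes "\<And>n u. 1 \<le> n \<Longrightarrow> 0 \<le> u \<Longrightarrow> comparable_distances (D n u) (h n u)"
  shows "cutoff_times_c D t \<longleftrightarrow> cutoff_times_c h t"
proof -
  have ev: "\<forall>\<^sub>F n in sequentially. comparable_distances (D n (a * t n)) (h n (a * t n))"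
    if "\<forall>n\<ge>1. 0 < t n" "0 < a" for a
    using eventually_ge_at_top[of 1]
  proof eventually_elim
    case (elim n)
    then have "0 \<le> a * t n"
      using that by (simp add: less_imp_le)
    then show ?case
      using elim by (intro assms)
  qed
  show ?thesis
    unfolding cutoff_times_c_def
    by (intro conj_cong refl all_cong1 imp_cong
        comparable_tendsto_0[OF ev] comparable_tendsto_1[OF ev]) auto
qed

text \<open>
  For positive \<open>t\<close>, this says that \<open>T n / t n\<close> tends to 1.  The sandwich form avoids arithmetic on mixing times, which
  may be infinite for finitely many \<open>n\<close>.
\<close>

definition asymptotic_to :: "(nat \<Rightarrow> ereal) \<Rightarrow> (nat \<Rightarrow> real) \<Rightarrow> bool" where
  "asymptotic_to T t \<longleftrightarrow>
    (\<forall>a b. 0 < a \<and> a < 1 \<and> 1 < b \<longrightarrow>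
      (\<forall>\<^sub>F n in sequentially. ereal (a * t n) \<le> T n \<and> T n \<le> ereal (b * t n)))"

lemma asymptotic_to_imp_quotient:
  assumes T: "asymptotic_to T t" and t: "\<forall>n\<ge>1. 0 < t n"
  obtains u where "u \<longlonglongrightarrow> 1" "\<forall>\<^sub>F n in sequentially. T n = ereal (u n * t n)"
proof
  define u where "u n = real_of_ereal (T n) / t n" for n
  have t_pos: "\<forall>\<^sub>F n in sequentially. 0 < t n"
    using t eventually_sequentially by blast
  have bounds: "\<forall>\<^sub>F n in sequentially. a \<le> u n \<and> u n \<le> b \<and> T n = ereal (u n * t n)"
    if "0 < a" "a < 1" "1 < b" for a b
  proof -
    have "\<forall>\<^sub>F n in sequentially. ereal (a * t n) \<le> T n \<and> T n \<le> ereal (b * t n)"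
      using T that by (auto simp: asymptotic_to_def)
    with t_pos show ?thesis
    proof eventually_elim
      case (elim n)
      then show ?case
        by (cases "T n") (auto simp: u_def field_simps)
    qed
  qed
  show "\<forall>\<^sub>F n in sequentially. T n = ereal (u n * t n)"
    using bounds[of "1 / 2" 2] by (auto elim: eventually_mono)
  show "u \<longlonglongrightarrow> 1"
  proof (rule order_tendstoI)
    fix l :: real assume "l < 1"
    define a where "a = (1 + max l 0) / 2"
    have a: "0 < a" "a < 1" "l < a"
      using \<open>l < 1\<close> by (auto simp: a_def max_def)
    show "\<forall>\<^sub>F n in sequentially. l < u n"
      using bounds[OF a(1,2), of 2] by (rule eventually_mono) (use a(3) in auto)
  next
    fix l :: real assume "1 < l"
    then show "\<forall>\<^sub>F n in sequentially. u n < l"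
      using bounds[of "1 / 2" "(1 + l) / 2"] by (auto elim!: eventually_mono)
  qed
qed

lemma asymptotic_to_ratio:
  assumes S: "asymptotic_to S t" and T: "asymptotic_to T t" and t: "\<forall>n\<ge>1. 0 < t n"
  shows "(\<lambda>n. S n / T n) \<longlonglongrightarrow> 1"
proof -
  obtain u where u: "u \<longlonglongrightarrow> 1" "\<forall>\<^sub>F n in sequentially. S n = ereal (u n * t n)"
    using asymptotic_to_imp_quotient[OF S t] .
  obtain v where v: "v \<longlonglongrightarrow> 1" "\<forall>\<^sub>F n in sequentially. T n = ereal (v n * t n)"
    using asymptotic_to_imp_quotient[OF T t] .
  have t_pos: "\<forall>\<^sub>F n in sequentially. 0 < t n"
    using t eventually_sequentially by blast
  have v_pos: "\<forall>\<^sub>F n in sequentially. 0 < v n"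
    using order_tendstoD(1)[OF v(1), of 0] by simp
  have "(\<lambda>n. ereal (u n / v n)) \<longlonglongrightarrow> ereal (1 / 1)"
    by (intro tendsto_intros u v) simp
  moreover have "\<forall>\<^sub>F n in sequentially. ereal (u n / v n) = S n / T n"
    using u(2) v(2) t_pos v_pos by eventually_elim simp
  ultimately show ?thesis
    using Lim_transform_eventually by (fastforce simp: one_ereal_def)
qed

text \<open>
  The summand 1 is the price of rounding up to an integer time.
\<close>

lemma mixing_time_upper:
  assumes "cutoff_times d t" "0 < \<epsilon>" "1 < b"
  shows "\<forall>\<^sub>F n in sequentially. mixing_time (d n) \<epsilon> \<le> ereal (b * t n + 1)"
proof -
  have "(\<lambda>n. d n (nat \<lceil>b * t n\<rceil>)) \<longlonglongrightarrow> 0" "\<forall>n\<ge>1. 0 < t n"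
    using assms by (auto simp: cutoff_times_def)
  then have "\<forall>\<^sub>F n in sequentially. d n (nat \<lceil>b * t n\<rceil>) < \<epsilon>" "\<forall>\<^sub>F n in sequentially. 0 < t n"
    using assms(2) order_tendstoD(2) eventually_sequentially by blast+
  then show ?thesis
  proof eventually_elim
    case (elim n)
    have "mixing_time (d n) \<epsilon> \<le> ereal (real (nat \<lceil>b * t n\<rceil>))"
      unfolding mixing_time_def using elim by (intro Inf_lower) auto
    also have "real (nat \<lceil>b * t n\<rceil>) \<le> b * t n + 1"
      using elim assms(3) by (simp add: of_nat_nat)
    finally show ?case
      by simp
  qed
qed

text \<open>
  The upper bound needs the distance at a single time only.  The lower bound needs monotonicity: a
  large distance at \<open>a * t n\<close> must rule out all earlier times.  Divergence of \<open>t\<close> makes the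
  rounding error negligible.
\<close>

lemma mixing_time_asymptotic:
  assumes cut: "cutoff_times d t" and anti: "\<And>n. 1 \<le> n \<Longrightarrow> antimono (d n)"
    and t: "filterlim t at_top sequentially" and \<epsilon>: "0 < \<epsilon>" "\<epsilon> < 1"
  shows "asymptotic_to (\<lambda>n. mixing_time (d n) \<epsilon>) t"
  unfolding asymptotic_to_def
proof (intro allI impI eventually_conj; elim conjE)
  fix a b :: real
  assume ab: "0 < a" "a < 1" "1 < b"
  have "(\<lambda>n. d n (nat \<lfloor>a * t n\<rfloor>)) \<longlonglongrightarrow> 1"
    using cut ab by (simp add: cutoff_times_def)
  then have "\<forall>\<^sub>F n in sequentially. \<epsilon> < d n (nat \<lfloor>a * t n\<rfloor>)"
    using \<epsilon>(2) order_tendstoD(1) by blast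
  with eventually_ge_at_top[of 1]
  show "\<forall>\<^sub>F n in sequentially. ereal (a * t n) \<le> mixing_time (d n) \<epsilon>"
  proof eventually_elim
    case (elim n)
    show ?case
      unfolding mixing_time_def
    proof (intro Inf_greatest, clarify)
      fix m assume "d n m \<le> \<epsilon>"
      then have "\<not> m \<le> nat \<lfloor>a * t n\<rfloor>"
        using antimonoD[OF anti[OF elim(1)]] elim(2) by fastforce
      then have "a * t n \<le> real m"
        by linarith
      then show "ereal (a * t n) \<le> ereal (real m)"
        by simp
    qed
  qed
  \<comment> \<open>The gap between (1 + b) / 2 and b absorbs the rounding error once t n is large.\<close>
  have "\<forall>\<^sub>F n in sequentially. mixing_time (d n) \<epsilon> \<le> ereal ((1 + b) / 2 * t n + 1)"
    using ab by (intro mixing_time_upper[OF cut \<epsilon>(1)]) simp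
  moreover have "\<forall>\<^sub>F n in sequentially. 2 / (b - 1) \<le> t n"
    using t by (simp add: filterlim_at_top)
  ultimately show "\<forall>\<^sub>F n in sequentially. mixing_time (d n) \<epsilon> \<le> ereal (b * t n)"
  proof eventually_elim
    case (elim n)
    have "(1 + b) / 2 * t n + 1 \<le> b * t n"
      using elim(2) ab by (simp add: field_simps)
    then have "ereal ((1 + b) / 2 * t n + 1) \<le> ereal (b * t n)"
      by simp
    with elim(1) show ?case
      by (rule order_trans)
  qed
qed

text \<open>
  Divergence of one mixing time of one distance suffices to make rounding harmless for both
  distances, since they share their cutoff times.
\<close>

lemma cutoff_times_at_top:
  assumes cut: "cutoff_times d t" and \<epsilon>: "0 < \<epsilon>"
    and T: "(\<lambda>n. mixing_time (d n) \<epsilon>) \<longlonglongrightarrow> \<infinity>"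
  shows "filterlim t at_top sequentially"
  unfolding filterlim_at_top
proof
  fix M :: real
  have "\<forall>\<^sub>F n in sequentially. mixing_time (d n) \<epsilon> \<le> ereal (2 * t n + 1)"
    by (rule mixing_time_upper[OF cut \<epsilon>]) simp
  moreover have "\<forall>\<^sub>F n in sequentially. ereal (2 * M + 1) < mixing_time (d n) \<epsilon>"
    using T by (simp add: tendsto_PInfty)
  ultimately show "\<forall>\<^sub>F n in sequentially. M \<le> t n"
  proof eventually_elim
    case (elim n)
    then have "ereal (2 * M + 1) < ereal (2 * t n + 1)"
      by (rule less_le_trans[rotated])
    then show ?case
      by simp
  qed
qed

lemma mixing_time_c_asymptotic:
  assumes cut: "cutoff_times_c d t"
    and anti: "\<And>n s u. 1 \<le> n \<Longrightarrow> 0 \<le> s \<Longrightarrow> s \<le> u \<Longrightarrow> d n u \<le> d n s"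
    and \<epsilon>: "0 < \<epsilon>" "\<epsilon> < 1"
  shows "asymptotic_to (\<lambda>n. mixing_time_c (d n) \<epsilon>) t"
  unfolding asymptotic_to_def
proof (intro allI impI eventually_conj; elim conjE)
  fix a b :: real
  assume ab: "0 < a" "a < 1" "1 < b"
  have t: "\<forall>n\<ge>1. 0 < t n"
    using cut by (simp add: cutoff_times_c_def)
  have "(\<lambda>n. d n (a * t n)) \<longlonglongrightarrow> 1"
    using cut ab by (simp add: cutoff_times_c_def)
  then have "\<forall>\<^sub>F n in sequentially. \<epsilon> < d n (a * t n)"
    using \<epsilon>(2) order_tendstoD(1) by blast
  with eventually_ge_at_top[of 1]
  show "\<forall>\<^sub>F n in sequentially. ereal (a * t n) \<le> mixing_time_c (d n) \<epsilon>"
  proof eventually_elim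
    case (elim n)
    show ?case
      unfolding mixing_time_c_def
    proof (intro Inf_greatest, clarify)
      fix s assume "0 \<le> s" "d n s \<le> \<epsilon>"
      then have "\<not> s \<le> a * t n"
        using anti[OF elim(1), of s "a * t n"] elim(2) by linarith
      then show "ereal (a * t n) \<le> ereal s"
        by simp
    qed
  qed
  have "(\<lambda>n. d n (b * t n)) \<longlonglongrightarrow> 0"
    using cut ab by (simp add: cutoff_times_c_def)
  then have "\<forall>\<^sub>F n in sequentially. d n (b * t n) < \<epsilon>"
    using \<epsilon>(1) order_tendstoD(2) by blast
  with eventually_ge_at_top[of 1]
  show "\<forall>\<^sub>F n in sequentially. mixing_time_c (d n) \<epsilon> \<le> ereal (b * t n)"
  proof eventually_elim
    case (elim n)
    then have "0 \<le> b * t n"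
      using t ab by (simp add: less_imp_le)
    then show ?case
      unfolding mixing_time_c_def using elim by (intro Inf_lower) auto
  qed
qed

theorem proposition1p1:
  fixes X :: "nat \<Rightarrow> 'a set"
    and K :: "nat \<Rightarrow> 'a \<Rightarrow> 'a \<Rightarrow> real"
    and \<pi> :: "nat \<Rightarrow> 'a \<Rightarrow> real"
  assumes "\<And>n. n \<ge> 1 \<Longrightarrow> markov_chain (X n) (K n) (\<pi> n)"
  defines "dTV \<equiv> \<lambda>n. d_TV (X n) (K n) (\<pi> n)"
    and "dH \<equiv> \<lambda>n. d_H (X n) (K n) (\<pi> n)"
    and "dcTV \<equiv> \<lambda>n. dc_TV (X n) (K n) (\<pi> n)"
    and "dcH \<equiv> \<lambda>n. dc_H (X n) (K n) (\<pi> n)"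
  shows "((\<exists>\<epsilon>0. 0 < \<epsilon>0 \<and> \<epsilon>0 < 1 \<and>
              ((\<lambda>n. mixing_time (dTV n) \<epsilon>0) \<longlonglongrightarrow> \<infinity> \<or> (\<lambda>n. mixing_time (dH n) \<epsilon>0) \<longlonglongrightarrow> \<infinity>)) \<longrightarrow>
            (cutoff dTV \<longleftrightarrow> cutoff dH) \<and>
            (cutoff dTV \<or> cutoff dH \<longrightarrow>
              (\<forall>\<epsilon> \<delta>. 0 < \<epsilon> \<and> \<epsilon> < 1 \<and> 0 < \<delta> \<and> \<delta> < 1 \<longrightarrow>
                (\<lambda>n. mixing_time (dTV n) \<epsilon> / mixing_time (dH n) \<delta>) \<longlonglongrightarrow> 1))) \<and>
         ((cutoff_c dcTV \<longleftrightarrow> cutoff_c dcH) \<and>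
            (cutoff_c dcTV \<or> cutoff_c dcH \<longrightarrow>
              (\<forall>\<epsilon> \<delta>. 0 < \<epsilon> \<and> \<epsilon> < 1 \<and> 0 < \<delta> \<and> \<delta> < 1 \<longrightarrow>
                (\<lambda>n. mixing_time_c (dcTV n) \<epsilon> / mixing_time_c (dcH n) \<delta>) \<longlonglongrightarrow> 1)))"
proof -
  note chain = assms(1)
  have times: "cutoff_times dTV t \<longleftrightarrow> cutoff_times dH t" for t
    unfolding dTV_def dH_def d_TV_def d_H_def
    by (intro cutoff_times_comparable markov_kernel.comparable_max_dists markov_kernel_power chain)
  have times_c: "cutoff_times_c dcTV t \<longleftrightarrow> cutoff_times_c dcH t" for t
    unfolding dcTV_def dcH_def dc_TV_def dc_H_def
    by (intro cutoff_times_c_comparable markov_kernel.comparable_max_dists markov_kernel_heat chain)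
  have discrete: "(\<lambda>n. mixing_time (dTV n) \<epsilon> / mixing_time (dH n) \<delta>) \<longlonglongrightarrow> 1"
    if cut: "cutoff dTV \<or> cutoff dH" and eps: "0 < \<epsilon>" "\<epsilon> < 1" "0 < \<delta>" "\<delta> < 1" "0 < \<epsilon>0"
      and T: "(\<lambda>n. mixing_time (dTV n) \<epsilon>0) \<longlonglongrightarrow> \<infinity> \<or> (\<lambda>n. mixing_time (dH n) \<epsilon>0) \<longlonglongrightarrow> \<infinity>"
    for \<epsilon> \<delta> \<epsilon>0
  proof -
    \<comment> \<open>One sequence of cutoff times serves both distances, and both mixing times are compared with it.\<close>
    obtain t where t: "cutoff_times dTV t" "cutoff_times dH t"
      using cut times by (auto simp: cutoff_iff)
    have t_top: "filterlim t at_top sequentially"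
      using T t eps(5) cutoff_times_at_top by blast
    have "asymptotic_to (\<lambda>n. mixing_time (dTV n) \<epsilon>) t"
      using antimono_d_TV[OF chain] by (intro mixing_time_asymptotic t t_top eps) (simp add: dTV_def)
    moreover have "asymptotic_to (\<lambda>n. mixing_time (dH n) \<delta>) t"
      using antimono_d_H[OF chain] by (intro mixing_time_asymptotic t t_top eps) (simp add: dH_def)
    ultimately show ?thesis
      using t by (intro asymptotic_to_ratio) (auto simp: cutoff_times_def)
  qed
  have continuous: "(\<lambda>n. mixing_time_c (dcTV n) \<epsilon> / mixing_time_c (dcH n) \<delta>) \<longlonglongrightarrow> 1"
    if cut: "cutoff_c dcTV \<or> cutoff_c dcH" and eps: "0 < \<epsilon>" "\<epsilon> < 1" "0 < \<delta>" "\<delta> < 1"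
    for \<epsilon> \<delta>
  proof -
    obtain t where t: "cutoff_times_c dcTV t" "cutoff_times_c dcH t"
      using cut times_c by (auto simp: cutoff_c_iff)
    have "asymptotic_to (\<lambda>n. mixing_time_c (dcTV n) \<epsilon>) t"
      using dc_TV_decreasing[OF chain] by (intro mixing_time_c_asymptotic t eps) (simp add: dcTV_def)
    moreover have "asymptotic_to (\<lambda>n. mixing_time_c (dcH n) \<delta>) t"
      using dc_H_decreasing[OF chain] by (intro mixing_time_c_asymptotic t eps) (simp add: dcH_def)
    ultimately show ?thesis
      using t by (intro asymptotic_to_ratio) (auto simp: cutoff_times_c_def)
  qed
  show ?thesis
  proof (intro conjI impI allI; (elim exE conjE)?)
    show "cutoff dTV \<longleftrightarrow> cutoff dH" "cutoff_c dcTV \<longleftrightarrow> cutoff_c dcH"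
      using times times_c by (simp_all add: cutoff_iff cutoff_c_iff)
  qed (blast intro: discrete continuous)+
qed

end
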